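(* Let $\lambda\in\mathbb{C}$ be an eigenvalue of $\mathcal P^{-1}\mathcal A$ and let $u=(u_1,\dots,u_{N+1})$, with $u_j\in\mathbb{C}^{n_{j-1}}$ and $\sum_{j=1}^{N+1}\|u_j\|^2=1$, be an associated eigenvector of the generalized eigenvalue problem $\mathcal M u=\lambda\,\mathcal T u$. Assume $u_j\neq 0$ for $j=3,\dots,N+1$. (i) If $\alpha_E^{(0)}\|u_1\|^2+\alpha_E^{(1)}\|u_2\|^2\ge 1$, then $\lambda$ cannot be complex (i.e. $\lambda$ is real). (ii) Otherwise, if $\lambda=\lambda_R+\mathrm{i}\,\lambda_I$ is complex (i.e. $\lambda_I\neq 0$), then $$|\lambda-1|<\sqrt{1-\alpha_E^{(0)}\|u_1\|^2-\alpha_E^{(1)}\|u_2\|^2}\qquad\text{and}\qquad \lambda_R>\frac{\alpha_E^{(0)}\|u_1\|^2+\alpha_E^{(1)}\|u_2\|^2}{2}.$$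
   Context: Let $N\ge 1$. Let $A_0\in\mathbb{R}^{n_0\times n_0}$ be symmetric positive definite, $A_k\in\mathbb{R}^{n_k\times n_k}$ symmetric positive semi-definite for $k=1,\dots,N$, and let $B_k\in\mathbb{R}^{n_k\times n_{k-1}}$ have full rank with $n_k\le n_{k-1}$ for $k=1,\dots,N$. Let $\widehat S_k\in\mathbb{R}^{n_k\times n_k}$, $k=0,\dots,N$, be symmetric positive definite (they play the role of approximations of $\widetilde S_0=A_0$ and $\widetilde S_k=A_k+B_k\widehat S_{k-1}^{-1}B_k^\top$). $\mathcal A$ is the symmetric block-tridiagonal matrix with diagonal blocks $A_0,-A_1,A_2,\dots,(-1)^NA_N$, sub-diagonal blocks $B_1,\dots,B_N$ and super-diagonal blocks $B_1^\top,\dots,B_N^\top$. $\mathcal P$ is the block upper bidiagonal matrix with diagonal blocks $\widehat S_0,-\widehat S_1,\widehat S_2,\dots,(-1)^N\widehat S_N$ and super-diagonal blocks $B_1^\top,\dots,B_N^\top$. Set $E_k=\widehat S_k^{-1/2}A_k\widehat S_k^{-1/2}$ ($k=0,\dots,N$) and $R_k=\widehat S_k^{-1/2}B_k\widehat S_{k-1}^{-1/2}$ ($k=1,\dots,N$). With $\mathcal D=\mathrm{diag}(\widehat S_0,\dots,\widehat S_N)$, let $\mathcal M=\mathcal D^{-1/2}\mathcal A\mathcal D^{-1/2}$ and $\mathcal T=\mathcal D^{-1/2}\mathcal P\mathcal D^{-1/2}$. Thus $\mathcal M$ is block tridiagonal with diagonal blocks $(-1)^kE_k$ ($k=0,\dots,N$),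 sub-diagonal blocks $R_k$ and super-diagonal blocks $R_k^\top$ ($k=1,\dots,N$); $\mathcal T$ is block upper bidiagonal with diagonal blocks $(-1)^kI$ and super-diagonal blocks $R_k^\top$. The eigenvalues of $\mathcal P^{-1}\mathcal A$ are exactly the $\lambda$ for which $\mathcal M u=\lambda\mathcal T u$ has a solution $u\neq 0$. $\alpha_E^{(k)}$ denotes the smallest eigenvalue of $E_k$, so $\alpha_E^{(0)}>0$ and $\alpha_E^{(k)}\ge 0$ for $k\ge 1$. $\|\cdot\|$ is the Euclidean norm. "Complex eigenvalue" means an eigenvalue with non-zero imaginary part. *)

theory Defs
  imports
    "HOL-Analysis.L2_Norm"
    "Jordan_Normal_Form.DL_Rank"
    "Jordan_Normal_Form.Gauss_Jordan_Elimination"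
    "Jordan_Normal_Form.Spectral_Radius"
begin

section \<open>Symmetric (semi-)definite matrices and square roots\<close>

definition sym_pos_semidef :: "real mat \<Rightarrow> bool" where
  "sym_pos_semidef S \<longleftrightarrow> square_mat S \<and> S\<^sup>T = S \<and>
     (\<forall>x \<in> carrier_vec (dim_row S). x \<bullet> (S *\<^sub>v x) \<ge> 0)"

definition sym_pos_def :: "real mat \<Rightarrow> bool" where
  "sym_pos_def S \<longleftrightarrow> square_mat S \<and> S\<^sup>T = S \<and>
     (\<forall>x \<in> carrier_vec (dim_row S). x \<noteq> 0\<^sub>v (dim_row S) \<longrightarrow> x \<bullet> (S *\<^sub>v x) > 0)"

text \<open>The square root and its inverse are meaningful only for symmetric positive definite
  arguments, where the positive definite root exists and is unique.\<close>

definition sqrt_mat :: "real mat \<Rightarrow> real mat" where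
  "sqrt_mat S = (THE X. sym_pos_def X \<and> X * X = S)"

definition inv_sqrt_mat :: "real mat \<Rightarrow> real mat" where
  "inv_sqrt_mat S = the (mat_inverse (sqrt_mat S))"

definition scaled_mat :: "real mat \<Rightarrow> real mat \<Rightarrow> real mat" where
  "scaled_mat S X = inv_sqrt_mat S * X * inv_sqrt_mat S"

text \<open>\<^const>\<open>spectrum\<close> is taken over the reals here; for a nonempty symmetric matrix it is
  finite, nonempty, and contains all eigenvalues.\<close>

definition min_eigenvalue :: "real mat \<Rightarrow> real" where
  "min_eigenvalue X = Min (spectrum X)"

definition eucl_norm :: "complex vec \<Rightarrow> real" where
  "eucl_norm v = L2_set (\<lambda>i. cmod (v $ i)) {..<dim_vec v}"


section \<open>Block matrices\<close>

text \<open>Blocks are numbered \<open>0, \<dots>, N\<close>, with block \<open>k\<close> of size \<open>n k\<close>. Global index \<open>i\<close> lies in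
  block \<open>block_of n i\<close>, whose first global index is \<open>block_start n (block_of n i)\<close>.\<close>

definition block_start :: "(nat \<Rightarrow> nat) \<Rightarrow> nat \<Rightarrow> nat" where
  "block_start n k = (\<Sum>j<k. n j)"

definition block_of :: "(nat \<Rightarrow> nat) \<Rightarrow> nat \<Rightarrow> nat" where
  "block_of n i = (LEAST k. i < block_start n (Suc k))"

definition block_mat ::
  "(nat \<Rightarrow> nat) \<Rightarrow> nat \<Rightarrow> (nat \<Rightarrow> nat \<Rightarrow> 'a mat) \<Rightarrow> 'a mat" where
  "block_mat n N F = mat (block_start n (Suc N)) (block_start n (Suc N))
     (\<lambda>(i, j). F (block_of n i) (block_of n j) $$
        (i - block_start n (block_of n i), j - block_start n (block_of n j)))"

definition vec_block :: "(nat \<Rightarrow> nat) \<Rightarrow> 'a vec \<Rightarrow> nat \<Rightarrow> 'a vec" where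
  "vec_block n u k = vec (n k) (\<lambda>i. u $ (block_start n k + i))"

definition saddle_mat ::
  "(nat \<Rightarrow> nat) \<Rightarrow> nat \<Rightarrow> (nat \<Rightarrow> real mat) \<Rightarrow> (nat \<Rightarrow> real mat) \<Rightarrow> real mat" where
  "saddle_mat n N A B = block_mat n N (\<lambda>k l.
     if k = l then (-1) ^ k \<cdot>\<^sub>m A k
     else if k = Suc l then B k
     else if l = Suc k then (B l)\<^sup>T
     else 0\<^sub>m (n k) (n l))"

definition precond_mat ::
  "(nat \<Rightarrow> nat) \<Rightarrow> nat \<Rightarrow> (nat \<Rightarrow> real mat) \<Rightarrow> (nat \<Rightarrow> real mat) \<Rightarrow> real mat" where
  "precond_mat n N S B = block_mat n N (\<lambda>k l.
     if k = l then (-1) ^ k \<cdot>\<^sub>m S k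
     else if l = Suc k then (B l)\<^sup>T
     else 0\<^sub>m (n k) (n l))"

definition block_diag_mat ::
  "(nat \<Rightarrow> nat) \<Rightarrow> nat \<Rightarrow> (nat \<Rightarrow> real mat) \<Rightarrow> real mat" where
  "block_diag_mat n N S = block_mat n N (\<lambda>k l. if k = l then S k else 0\<^sub>m (n k) (n l))"

end

theory Submission
  imports Defs
begin

text \<open>
The substitution \<open>y = D\<^sup>-\<^sup>1\<^sup>/\<^sup>2 u\<close>, where \<open>D\<close> is the block diagonal matrix of the \<open>S\<^sub>k\<close>, turns the scaled
problem into \<open>A y = \<lambda> P y\<close> for the unscaled block matrices. Test block row \<open>k\<close> with \<open>y\<^sub>k\<close>, and write
\<open>w\<^sub>k = y\<^sub>k\<^sup>* S\<^sub>k y\<^sub>k = \<parallel>u\<^sub>k\<parallel>\<^sup>2\<close>, \<open>e\<^sub>k = y\<^sub>k\<^sup>* A\<^sub>k y\<^sub>k\<close>, \<open>p\<^sub>k = (- 1)\<^sup>k y\<^sub>k\<^sup>* B\<^sub>k y\<^sub>k\<^sub>-\<^sub>1\<close> and \<open>\<mu> = \<lambda> - 1\<close>. All rows then have the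
same shape \<open>p\<^sub>k + \<mu> cnj p\<^sub>k\<^sub>+\<^sub>1 = (1 + \<mu>) w\<^sub>k - e\<^sub>k\<close>, with \<open>p\<^sub>0 = p\<^sub>N\<^sub>+\<^sub>1 = 0\<close>, real \<open>w\<^sub>k\<close> and \<open>e\<^sub>k\<close>. Blocks are
numbered from 0, so \<open>u\<^sub>0\<close> and \<open>u\<^sub>1\<close> are the two blocks that occur in the bound.

A suitable combination of these rows and their conjugates eliminates all couplings \<open>p\<^sub>k\<close> at once
(\<open>complex_coupling_bound\<close>). If \<open>\<lambda>\<close> is not real, its real and imaginary parts combine to
\<open>E = (1 - |\<mu>|\<^sup>2) W\<close>, where \<open>E\<close> is a weighted sum of all energies \<open>e\<^sub>k\<close> that contains \<open>e\<^sub>0 + e\<^sub>1\<close> with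
weight one, and \<open>W\<close> is a weighted sum of the \<open>w\<^sub>k\<close> with odd \<open>k\<close>. Full rank of the \<open>B\<^sub>k\<close> makes \<open>u\<^sub>0\<close>
nonzero, so \<open>E > 0\<close> and \<open>|\<mu>| < 1\<close>. The weights, powers of \<open>|\<mu>|\<^sup>2\<close>, are therefore at most one, which
gives \<open>W < 1\<close> and \<open>e\<^sub>0 + e\<^sub>1 \<le> E < 1 - |\<mu>|\<^sup>2\<close>
(\<open>nonreal_eigenvalue_bound\<close>). By the Rayleigh quotient bound (\<open>scaled_block_forms\<close>), \<open>e\<^sub>0 + e\<^sub>1\<close> is at
least the quantity \<open>a\<close> of the theorem. So a nonreal \<open>\<lambda>\<close> satisfies \<open>|\<lambda> - 1|\<^sup>2 < 1 - a\<close>; this excludes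
\<open>a \<ge> 1\<close>, and expanding the square gives the bound on the real part.

The square root of a matrix is defined by a unique description, so its existence and uniqueness for
positive definite matrices have to be established; they, and the Rayleigh quotient bound, rest on
the spectral theorem for real symmetric matrices (\<open>symmetric_diagonalization\<close>). Uniqueness also
identifies the square root of \<open>D\<close> with the block diagonal matrix of the square roots of the \<open>S\<^sub>k\<close>.
\<close>

section \<open>Hermitian forms of real matrices\<close>

text \<open>This is \<open>x\<^sup>* M y\<close>. The matrix stays real, so that symmetry and definiteness are properties of \<open>M\<close>
itself, while the vectors come from a complex eigenvector.\<close>

definition sesq_form :: "real mat \<Rightarrow> complex vec \<Rightarrow> complex vec \<Rightarrow> complex" where
  "sesq_form M x y = conjugate x \<bullet> (map_mat complex_of_real M *\<^sub>v y)"

lemma sesq_form_sum: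
  assumes "M \<in> carrier_mat a b" "x \<in> carrier_vec a" "y \<in> carrier_vec b"
  shows "sesq_form M x y
    = (\<Sum>i<a. \<Sum>j<b. cnj (x $ i) * complex_of_real (M $$ (i, j)) * y $ j)"
  using assms
  by (auto simp: sesq_form_def scalar_prod_def mult_mat_vec_def sum_distrib_left mult.assoc
      atLeast0LessThan intro!: sum.cong)

lemma cnj_sesq_form:
  assumes "M \<in> carrier_mat a b" "x \<in> carrier_vec a" "y \<in> carrier_vec b"
  shows "cnj (sesq_form M x y) = sesq_form M\<^sup>T y x"
proof -
  have "sesq_form M\<^sup>T y x
      = (\<Sum>j<b. \<Sum>i<a. cnj (y $ j) * complex_of_real (M\<^sup>T $$ (j, i)) * x $ i)"
    using assms by (intro sesq_form_sum) auto
  also have "\<dots> = (\<Sum>j<b. \<Sum>i<a. cnj (y $ j) * complex_of_real (M $$ (i, j)) * x $ i)"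
    using assms by (intro sum.cong) auto
  also have "\<dots> = (\<Sum>i<a. \<Sum>j<b. cnj (y $ j) * complex_of_real (M $$ (i, j)) * x $ i)"
    by (rule sum.swap)
  also have "\<dots> = cnj (sesq_form M x y)"
    unfolding sesq_form_sum[OF assms] by (simp add: mult.commute mult.left_commute)
  finally show ?thesis by simp
qed

lemma sesq_form_symmetric_real:
  assumes M: "M \<in> carrier_mat n n" "M\<^sup>T = M" and y: "y \<in> carrier_vec n"
  shows "Im (sesq_form M y y) = 0"
proof -
  have "cnj (sesq_form M y y) = sesq_form M y y"
    using cnj_sesq_form[OF M(1) y y] M(2) by simp
  then show ?thesis by (metis Reals_cnj_iff complex_is_Real_iff)
qed

text \<open>Splitting a complex vector into its real and imaginary parts reduces bounds on \<open>y\<^sup>* M y\<close> to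
bounds on the real quadratic form of \<open>M\<close>.\<close>

lemma sesq_form_Re:
  assumes M: "M \<in> carrier_mat n n" and y: "y \<in> carrier_vec n"
  shows "Re (sesq_form M y y) = map_vec Re y \<bullet> (M *\<^sub>v map_vec Re y)
    + map_vec Im y \<bullet> (M *\<^sub>v map_vec Im y)"
proof -
  have quad: "x \<bullet> (M *\<^sub>v x) = (\<Sum>i<n. \<Sum>j<n. x $ i * M $$ (i, j) * x $ j)"
    if "x \<in> carrier_vec n" for x :: "real vec"
    using that M by (auto simp: scalar_prod_def mult_mat_vec_def sum_distrib_left mult.assoc
      atLeast0LessThan intro!: sum.cong)
  have "Re (sesq_form M y y)
      = (\<Sum>i<n. \<Sum>j<n. Re (y $ i) * M $$ (i, j) * Re (y $ j) + Im (y $ i) * M $$ (i, j) * Im (y $ j))"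
    unfolding sesq_form_sum[OF M y y] by simp
  also have "\<dots> = (\<Sum>i<n. \<Sum>j<n. map_vec Re y $ i * M $$ (i, j) * map_vec Re y $ j)
      + (\<Sum>i<n. \<Sum>j<n. map_vec Im y $ i * M $$ (i, j) * map_vec Im y $ j)"
    using y by (simp add: sum.distrib)
  finally show ?thesis using y by (simp add: quad)
qed

lemma sesq_form_one:
  assumes y: "y \<in> carrier_vec n"
  shows "sesq_form (1\<^sub>m n) y y = complex_of_real ((eucl_norm y)\<^sup>2)"
proof -
  have "sesq_form (1\<^sub>m n) y y = (\<Sum>i<n. \<Sum>j<n. if i = j then complex_of_real ((cmod (y $ i))\<^sup>2) else 0)"
    unfolding sesq_form_sum[OF one_carrier_mat y y]
    by (intro sum.cong refl) (simp only: complex_norm_square, auto simp: mult.commute)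
  also have "\<dots> = (\<Sum>i<n. complex_of_real ((cmod (y $ i))\<^sup>2))"
    by (intro sum.cong refl) simp
  also have "\<dots> = complex_of_real ((eucl_norm y)\<^sup>2)"
    using y by (simp add: eucl_norm_def L2_set_def sum_nonneg)
  finally show ?thesis .
qed

lemma sesq_form_zero_mat [simp]:
  "x \<in> carrier_vec a \<Longrightarrow> y \<in> carrier_vec b \<Longrightarrow> sesq_form (0\<^sub>m a b) x y = 0"
  by (simp add: sesq_form_sum[of _ a b])

lemma sesq_form_zero_right:
  "M \<in> carrier_mat a b \<Longrightarrow> x \<in> carrier_vec a \<Longrightarrow> sesq_form M x (0\<^sub>v b) = 0"
  by (simp add: sesq_form_sum)

lemma sesq_form_smult_mat:
  "M \<in> carrier_mat a b \<Longrightarrow> x \<in> carrier_vec a \<Longrightarrow> y \<in> carrier_vec b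
    \<Longrightarrow> sesq_form (c \<cdot>\<^sub>m M) x y = complex_of_real c * sesq_form M x y"
  by (simp add: sesq_form_sum[of _ a b] sum_distrib_left mult_ac)

lemma conjugate_real_mat_mult_vec:
  assumes "P \<in> carrier_mat a b" "x \<in> carrier_vec b"
  shows "conjugate (map_mat complex_of_real P *\<^sub>v x) = map_mat complex_of_real P *\<^sub>v conjugate x"
  using assms by (intro eq_vecI) (auto simp: scalar_prod_def)

text \<open>Moving the outer factors onto the arguments is how the scaling by the inverse square roots is
removed from the blocks \<open>E\<^sub>k\<close> and \<open>I\<close> of the scaled pencil.\<close>

lemma sesq_form_congruence:
  assumes P: "P \<in> carrier_mat m a" and M: "M \<in> carrier_mat m m"
    and x: "x \<in> carrier_vec a"
  shows "sesq_form (P\<^sup>T * M * P) x x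
    = sesq_form M (map_mat complex_of_real P *\<^sub>v x) (map_mat complex_of_real P *\<^sub>v x)"
proof -
  let ?P = "map_mat complex_of_real P" and ?M = "map_mat complex_of_real M"
  have cP: "?P \<in> carrier_mat m a" and cM: "?M \<in> carrier_mat m m" using P M by auto
  have Px: "?P *\<^sub>v x \<in> carrier_vec m" using cP x by simp
  have MPx: "?M *\<^sub>v (?P *\<^sub>v x) \<in> carrier_vec m" using cM Px by simp
  have "map_mat complex_of_real (P\<^sup>T * M * P) = ?P\<^sup>T * ?M * ?P"
    using P M by (simp add: of_real_hom.mat_hom_mult[of _ a m _ a] of_real_hom.mat_hom_mult[of _ a m _ m]
        of_real_hom.mat_hom_mult[of _ m m _ a]
        mult_carrier_mat[of _ a m _ m] map_mat_transpose)
  then have "map_mat complex_of_real (P\<^sup>T * M * P) *\<^sub>v x = ?P\<^sup>T *\<^sub>v (?M *\<^sub>v (?P *\<^sub>v x))"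
    using cP cM x Px by (simp add: assoc_mult_mat_vec[of _ a m _ a] assoc_mult_mat_vec[of _ a m _ m]
        mult_carrier_mat[of _ a m _ m])
  then have "sesq_form (P\<^sup>T * M * P) x x = conjugate x \<bullet> (?P\<^sup>T *\<^sub>v (?M *\<^sub>v (?P *\<^sub>v x)))"
    by (simp add: sesq_form_def)
  also have "\<dots> = (?P *\<^sub>v conjugate x) \<bullet> (?M *\<^sub>v (?P *\<^sub>v x))"
    using transpose_vec_mult_scalar[of "?P\<^sup>T" a m "?M *\<^sub>v (?P *\<^sub>v x)" "conjugate x"] cP MPx x by simp
  also have "?P *\<^sub>v conjugate x = conjugate (?P *\<^sub>v x)"
    using conjugate_real_mat_mult_vec[OF P x] by simp
  finally show ?thesis by (simp add: sesq_form_def)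
qed

section \<open>Spectral theorem for real symmetric matrices\<close>

text \<open>Over the complex numbers an eigenvalue \<open>c\<close> with eigenvector \<open>v\<close> exists; since
\<open>v\<^sup>* A v = c \<parallel>v\<parallel>\<^sup>2\<close> is real for symmetric \<open>A\<close>, so is \<open>c\<close>, and then it is a root of the real
characteristic polynomial.\<close>

lemma symmetric_real_eigenvalue:
  fixes A :: "real mat"
  assumes A: "A \<in> carrier_mat n n" "A\<^sup>T = A" and n: "n > 0"
  obtains e where "eigenvalue A e"
proof -
  let ?A = "map_mat complex_of_real A"
  have Ac: "?A \<in> carrier_mat n n" using A by simp
  from spectrum_non_empty[OF Ac n] obtain c where c: "eigenvalue ?A c"
    by (auto simp: spectrum_def)
  then obtain v where v: "v \<in> carrier_vec n" "v \<noteq> 0\<^sub>v n" "?A *\<^sub>v v = c \<cdot>\<^sub>v v"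
    using Ac by (auto simp: eigenvalue_def eigenvector_def)
  have "sesq_form A v v = c * (v \<bullet>c v)"
    using v by (simp add: sesq_form_def conjugate_vec_sprod_comm)
  also have "v \<bullet>c v = complex_of_real ((eucl_norm v)\<^sup>2)"
    using v sesq_form_one[OF v(1)]
    by (simp add: sesq_form_def of_real_hom.mat_hom_one conjugate_vec_sprod_comm)
  finally have "Im c * (eucl_norm v)\<^sup>2 = 0"
    using sesq_form_symmetric_real[OF A v(1)] by simp
  moreover have "(eucl_norm v)\<^sup>2 \<noteq> 0"
    using v \<open>v \<bullet>c v = _\<close> conjugate_square_eq_0_vec[OF v(1)] by auto
  ultimately have "c = complex_of_real (Re c)" by (simp add: complex_eq_iff)
  then have "poly (map_poly complex_of_real (char_poly A)) (complex_of_real (Re c)) = 0"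
    using c eigenvalue_root_char_poly[OF Ac] of_real_hom.char_poly_hom[OF A(1)] by metis
  then have "poly (char_poly A) (Re c) = 0" by simp
  then show ?thesis using that eigenvalue_root_char_poly[OF A(1)] by auto
qed

text \<open>The Householder reflection in the hyperplane orthogonal to \<open>w = v - e\<^sub>0\<close> maps the first unit
vector \<open>e\<^sub>0\<close> to \<open>v\<close>; it exists unless \<open>v = e\<^sub>0\<close>, where the identity does.\<close>

lemma orthogonal_mat_with_first_col:
  fixes v :: "real vec"
  assumes v: "v \<in> carrier_vec n" "v \<bullet> v = 1" and n: "n > 0"
  obtains W where "W \<in> carrier_mat n n" "W\<^sup>T * W = 1\<^sub>m n" "col W 0 = v"
proof (cases "v = unit_vec n 0")
  case True
  show ?thesis by (rule that[of "1\<^sub>m n"]) (use True n in auto)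
next
  case False
  define w where "w = v - unit_vec n 0"
  define c where "c = w \<bullet> w"
  have w: "w \<in> carrier_vec n" using v by (simp add: w_def)
  have "w \<noteq> 0\<^sub>v n"
  proof
    assume "w = 0\<^sub>v n"
    then have "w $ i = 0" if "i < n" for i using that by simp
    then have "v $ i = unit_vec n 0 $ i" if "i < n" for i
      using v that by (fastforce simp: w_def)
    with False v show False by (auto intro!: eq_vecI)
  qed
  then have c0: "c \<noteq> 0"
    using w conjugate_square_eq_0_vec[OF w] by (simp add: c_def)
  have "c = v \<bullet> v - 2 * v $ 0 + 1"
    using v n unfolding c_def w_def
    by (simp add: scalar_prod_minus_distrib[of _ n] minus_scalar_prod_distrib[of _ n])
  then have c: "c = - 2 * w $ 0" using v n by (simp add: w_def)
  \<comment> \<open>\<open>W = I - w \<alpha>\<^sup>T\<close> with \<open>\<alpha> = 2 w / (w \<bullet> w)\<close> is the reflection.\<close>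
  define \<alpha> where "\<alpha> i = 2 * w $ i / c" for i
  have \<alpha>: "\<alpha> i * c = 2 * w $ i" for i using c0 by (simp add: \<alpha>_def)
  define W where "W = mat n n (\<lambda>(i, j). (if i = j then 1 else 0) - w $ i * \<alpha> j)"
  have Wc: "W \<in> carrier_mat n n" by (simp add: W_def)
  have csum: "(\<Sum>k<n. w $ k * w $ k) = c"
    using w by (simp add: c_def scalar_prod_def atLeast0LessThan)
  have "W\<^sup>T * W = 1\<^sub>m n"
  proof (rule eq_matI)
    fix i j assume "i < dim_row (1\<^sub>m n)" "j < dim_col (1\<^sub>m n)"
    then have ij: "i < n" "j < n" by auto
    have "(W\<^sup>T * W) $$ (i, j) = (\<Sum>k<n. ((if k = i then 1 else 0) - w $ k * \<alpha> i)
        * ((if k = j then 1 else 0) - w $ k * \<alpha> j))"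
      using ij by (auto simp: W_def scalar_prod_def atLeast0LessThan intro!: sum.cong)
    also have "\<dots> = (\<Sum>k<n. (if k = i then (if i = j then 1 else 0) else 0)
        - (if k = i then w $ i * \<alpha> j else 0) - (if k = j then w $ j * \<alpha> i else 0)
        + (\<alpha> i * \<alpha> j) * (w $ k * w $ k))"
      by (intro sum.cong refl) (simp add: algebra_simps)
    also have "\<dots> = (if i = j then 1 else 0) - w $ i * \<alpha> j - w $ j * \<alpha> i + \<alpha> j * (\<alpha> i * c)"
      using ij by (simp add: sum.distrib sum_subtractf sum_distrib_left[symmetric] csum)
    also have "\<dots> = (if i = j then 1 else 0) - w $ i * \<alpha> j + w $ j * \<alpha> i - 2 * w $ j * \<alpha> i + \<alpha> j * (2 * w $ i)"
      by (simp add: \<alpha>)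
    also have "\<dots> = 1\<^sub>m n $$ (i, j)"
      using ij by (simp add: \<alpha>_def)
    finally show "(W\<^sup>T * W) $$ (i, j) = 1\<^sub>m n $$ (i, j)" .
  qed (auto simp: W_def)
  moreover have "col W 0 = v"
  proof (rule eq_vecI)
    fix i assume "i < dim_vec v"
    then have i: "i < n" using v by simp
    have "\<alpha> 0 = - 1" using c c0 by (simp add: \<alpha>_def field_simps)
    then show "col W 0 $ i = v $ i"
      using i n v by (simp add: W_def) (simp add: w_def)
  qed (use v Wc in auto)
  ultimately show ?thesis using that Wc by blast
qed

text \<open>Spectral theorem, by deflation: in an orthonormal basis that starts with an eigenvector, the
matrix splits into a one by one block and a symmetric block of smaller size.\<close>

theorem symmetric_diagonalization:
  fixes A :: "real mat"
  assumes "A \<in> carrier_mat n n" "A\<^sup>T = A"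
  shows "\<exists>Q d. Q \<in> carrier_mat n n \<and> Q\<^sup>T * Q = 1\<^sub>m n \<and> Q\<^sup>T * A * Q = mat_diag n d"
  using assms
proof (induction n arbitrary: A)
  case 0
  show ?case
    by (rule exI[of _ "1\<^sub>m 0"], rule exI[of _ "\<lambda>_. 0"]) (use 0 in \<open>auto simp: mat_diag_def intro!: eq_matI\<close>)
next
  case (Suc n A)
  let ?n = "Suc n"
  note A = Suc.prems
  from symmetric_real_eigenvalue[OF A] obtain e where "eigenvalue A e" by auto
  then obtain v0 where v0: "v0 \<in> carrier_vec ?n" "v0 \<noteq> 0\<^sub>v ?n" "A *\<^sub>v v0 = e \<cdot>\<^sub>v v0"
    using A by (auto simp: eigenvalue_def eigenvector_def)
  define v where "v = (1 / sqrt (v0 \<bullet> v0)) \<cdot>\<^sub>v v0"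
  have pos: "v0 \<bullet> v0 > 0"
    using conjugate_square_greater_0_vec[OF v0(1)] v0(2) by (simp add: conjugate_vec_def vec_eq_iff)
  have v: "v \<in> carrier_vec ?n" using v0 by (simp add: v_def)
  have "v \<bullet> v = 1" using v0 pos by (simp add: v_def power2_eq_square[symmetric])
  have Av: "A *\<^sub>v v = e \<cdot>\<^sub>v v"
    using v0 A by (simp add: v_def mult_mat_vec smult_smult_assoc mult.commute)
  obtain W where W: "W \<in> carrier_mat ?n ?n" "W\<^sup>T * W = 1\<^sub>m ?n" "col W 0 = v"
    using orthogonal_mat_with_first_col[OF v \<open>v \<bullet> v = 1\<close>] by auto
  define A' where "A' = W\<^sup>T * A * W"
  have A': "A' \<in> carrier_mat ?n ?n" using W A by (simp add: A'_def)
  have sym: "A'\<^sup>T = A'"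
    using A W by (simp add: A'_def transpose_mult[of _ ?n ?n _ ?n] assoc_mult_mat[of _ ?n ?n _ ?n _ ?n])
  have "col A' 0 = (W\<^sup>T * A) *\<^sub>v v"
    unfolding A'_def W(3)[symmetric]
    using W(1) A by (intro col_mult2[of _ ?n ?n _ ?n]) auto
  also have "\<dots> = e \<cdot>\<^sub>v (W\<^sup>T *\<^sub>v v)"
    using W A v by (simp add: assoc_mult_mat_vec[of _ ?n ?n _ ?n] Av mult_mat_vec[of _ ?n ?n])
  also have "W\<^sup>T *\<^sub>v v = unit_vec ?n 0"
    using W(1) col_mult2[of "W\<^sup>T" ?n ?n W ?n 0] by (simp add: W(2) flip: W(3))
  finally have col0: "col A' 0 = e \<cdot>\<^sub>v unit_vec ?n 0" .
  have c0: "A' $$ (i, 0) = (if i = 0 then e else 0)" if "i < ?n" for i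
    using arg_cong[OF col0, of "\<lambda>x. x $ i"] that A' by auto
  have r0: "A' $$ (0, i) = (if i = 0 then e else 0)" if "i < ?n" for i
    using c0[OF that] that A' sym by (metis index_transpose_mat(1) carrier_matD zero_less_Suc)
  define C where "C = mat n n (\<lambda>(i, j). A' $$ (Suc i, Suc j))"
  have C: "C \<in> carrier_mat n n" by (simp add: C_def)
  have symC: "C\<^sup>T = C"
  proof (rule eq_matI)
    fix i j assume "i < dim_row C" "j < dim_col C"
    then show "C\<^sup>T $$ (i, j) = C $$ (i, j)"
      using arg_cong[OF sym, of "\<lambda>M. M $$ (Suc i, Suc j)"] A' by (simp add: C_def)
  qed (auto simp: C_def)
  have A'_block: "A' = four_block_mat (e \<cdot>\<^sub>m 1\<^sub>m 1) (0\<^sub>m 1 n) (0\<^sub>m n 1) C"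
    by (rule eq_matI) (use A' in \<open>auto simp: c0 r0 C_def\<close>)
  obtain P d where P: "P \<in> carrier_mat n n" "P\<^sup>T * P = 1\<^sub>m n" "P\<^sup>T * C * P = mat_diag n d"
    using Suc.IH[OF C symC] by auto
  define R where "R = four_block_mat (1\<^sub>m 1) (0\<^sub>m 1 n) (0\<^sub>m n 1) P"
  have R: "R \<in> carrier_mat ?n ?n"
    using four_block_carrier_mat[of "1\<^sub>m 1" 1 1 P n n] P by (simp add: R_def)
  have RT: "R\<^sup>T = four_block_mat (1\<^sub>m 1) (0\<^sub>m 1 n) (0\<^sub>m n 1) P\<^sup>T"
    unfolding R_def using P by (subst transpose_four_block_mat[of _ 1 1 _ n _ n]) auto
  have RR: "R\<^sup>T * R = 1\<^sub>m ?n"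
    unfolding RT unfolding R_def using P
    by (subst mult_four_block_mat[of _ 1 1 _ n _ n _ _ 1 _ n])
      (auto simp: four_block_one_mat[of 1 n, simplified])
  have "R\<^sup>T * A' * R = four_block_mat (e \<cdot>\<^sub>m 1\<^sub>m 1) (0\<^sub>m 1 n) (0\<^sub>m n 1) (P\<^sup>T * C * P)"
    unfolding RT unfolding R_def A'_block using P C
    by (simp add: mult_four_block_mat[of _ 1 1 _ n _ n _ _ 1 _ n])
  also have "\<dots> = mat_diag ?n (case_nat e d)"
    unfolding P(3) by (rule eq_matI) (auto simp: mat_diag_def split: nat.splits)
  finally have RAR: "R\<^sup>T * A' * R = mat_diag ?n (case_nat e d)" .
  have QT: "(W * R)\<^sup>T = R\<^sup>T * W\<^sup>T" using W R by (simp add: transpose_mult[of _ ?n ?n _ ?n])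
  have "(W * R)\<^sup>T * (W * R) = R\<^sup>T * ((W\<^sup>T * W) * R)"
    unfolding QT using W(1) R by (simp add: assoc_mult_mat[of _ ?n ?n _ ?n _ ?n] mult_carrier_mat[of _ ?n ?n _ ?n])
  also have "\<dots> = 1\<^sub>m ?n" using W R RR by simp
  finally have 1: "(W * R)\<^sup>T * (W * R) = 1\<^sub>m ?n" .
  have "(W * R)\<^sup>T * A * (W * R) = R\<^sup>T * A' * R"
    unfolding QT A'_def using W(1) R A(1) by (simp add: assoc_mult_mat[of _ ?n ?n _ ?n _ ?n] mult_carrier_mat[of _ ?n ?n _ ?n])
  with RAR 1 W R show ?case by (intro exI[of _ "W * R"]) auto
qed

lemma symmetric_eigenbasis:
  fixes A :: "real mat"
  assumes A: "A \<in> carrier_mat n n" "A\<^sup>T = A"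
  obtains Q d where "Q \<in> carrier_mat n n" "Q\<^sup>T * Q = 1\<^sub>m n" "Q * Q\<^sup>T = 1\<^sub>m n"
    "A = Q * mat_diag n d * Q\<^sup>T"
    "\<And>i. i < n \<Longrightarrow> A *\<^sub>v col Q i = d i \<cdot>\<^sub>v col Q i"
    "\<And>i. i < n \<Longrightarrow> col Q i \<bullet> col Q i = 1"
proof -
  obtain Q d where Q: "Q \<in> carrier_mat n n" "Q\<^sup>T * Q = 1\<^sub>m n" "Q\<^sup>T * A * Q = mat_diag n d"
    using symmetric_diagonalization[OF A] by auto
  have QT: "Q\<^sup>T \<in> carrier_mat n n" using Q by simp
  have QQ: "Q * Q\<^sup>T = 1\<^sub>m n" using mat_mult_left_right_inverse[OF QT Q(1,2)] .
  note assoc = assoc_mult_mat[of _ n n _ n _ n]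
  have "Q * mat_diag n d = (Q * Q\<^sup>T) * (A * Q)"
    unfolding Q(3)[symmetric] using Q(1) A(1) by (simp add: assoc mult_carrier_mat[of _ n n _ n])
  then have AQ: "Q * mat_diag n d = A * Q" using QQ A Q by simp
  have "A = A * (Q * Q\<^sup>T)" using QQ A by simp
  also have "\<dots> = Q * mat_diag n d * Q\<^sup>T" unfolding AQ using A(1) Q(1) by (simp add: assoc mult_carrier_mat[of _ n n _ n])
  finally have AA: "A = Q * mat_diag n d * Q\<^sup>T" .
  have ev: "A *\<^sub>v col Q i = d i \<cdot>\<^sub>v col Q i" if "i < n" for i
  proof -
    have "A *\<^sub>v col Q i = col (A * Q) i" using col_mult2[OF A(1) Q(1) that] by simp
    also have "\<dots> = d i \<cdot>\<^sub>v col Q i"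
      unfolding AQ[symmetric] using Q that by (auto simp: mat_diag_mult_right intro!: eq_vecI)
    finally show ?thesis .
  qed
  have "col Q i \<bullet> col Q i = 1" if "i < n" for i
    using arg_cong[OF Q(2), of "\<lambda>M. M $$ (i, i)"] that Q(1) by simp
  with Q(1,2) QQ AA ev that show ?thesis by blast
qed

lemma scalar_prod_transpose:
  fixes M :: "real mat"
  assumes "M \<in> carrier_mat n m" "x \<in> carrier_vec n" "y \<in> carrier_vec m"
  shows "x \<bullet> (M *\<^sub>v y) = (M\<^sup>T *\<^sub>v x) \<bullet> y"
  using transpose_vec_mult_scalar[OF assms(1,3,2)] by simp

text \<open>In eigencoordinates \<open>z = Q\<^sup>T x\<close> the quadratic form is \<open>\<Sum>i. d\<^sub>i z\<^sub>i\<^sup>2\<close>, and every \<open>d\<^sub>i\<close> lies in the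
spectrum, hence is at least its minimum.\<close>

lemma min_eigenvalue_quadratic_form:
  fixes E :: "real mat"
  assumes E: "E \<in> carrier_mat n n" "E\<^sup>T = E" and x: "x \<in> carrier_vec n"
  shows "min_eigenvalue E * (x \<bullet> x) \<le> x \<bullet> (E *\<^sub>v x)"
proof -
  obtain Q d where Q: "Q \<in> carrier_mat n n" "Q\<^sup>T * Q = 1\<^sub>m n" "Q * Q\<^sup>T = 1\<^sub>m n"
    "E = Q * mat_diag n d * Q\<^sup>T"
    "\<And>i. i < n \<Longrightarrow> E *\<^sub>v col Q i = d i \<cdot>\<^sub>v col Q i"
    "\<And>i. i < n \<Longrightarrow> col Q i \<bullet> col Q i = 1"
    by (rule symmetric_eigenbasis[OF E]) auto
  have min: "min_eigenvalue E \<le> d i" if "i < n" for i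
  proof -
    have "col Q i \<noteq> 0\<^sub>v n" using Q(6)[OF that] Q(1) that by auto
    then have "eigenvector E (col Q i) (d i)"
      using E Q(1) Q(5)[OF that] that by (auto simp: eigenvector_def)
    then have "d i \<in> spectrum E" by (auto simp: spectrum_def eigenvalue_def)
    with card_finite_spectrum(1)[OF E(1)] show ?thesis by (simp add: min_eigenvalue_def)
  qed
  define z where "z = Q\<^sup>T *\<^sub>v x"
  have z: "z \<in> carrier_vec n" using Q x by (simp add: z_def)
  have Qz: "Q *\<^sub>v z = x"
    using Q x by (simp add: z_def assoc_mult_mat_vec[symmetric, of _ n n _ n])
  have "x \<bullet> x = x \<bullet> (Q *\<^sub>v z)" by (simp add: Qz)
  also have "\<dots> = z \<bullet> z" using scalar_prod_transpose[OF Q(1) x z] by (simp add: z_def)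
  finally have xx: "x \<bullet> x = (\<Sum>i<n. z $ i * z $ i)"
    using z by (simp add: scalar_prod_def atLeast0LessThan)
  have "E *\<^sub>v x = Q *\<^sub>v (mat_diag n d *\<^sub>v z)"
    using Q x by (simp add: Q(4) z_def assoc_mult_mat_vec[of _ n n _ n])
  then have "x \<bullet> (E *\<^sub>v x) = z \<bullet> (mat_diag n d *\<^sub>v z)"
    using scalar_prod_transpose[OF Q(1) x mult_mat_vec_carrier[OF mat_diag_dim z]]
    by (simp add: z_def)
  also have "\<dots> = (\<Sum>i<n. d i * (z $ i * z $ i))"
  proof -
    have "(mat_diag n d *\<^sub>v z) $ i = d i * z $ i" if "i < n" for i
    proof -
      have "(mat_diag n d *\<^sub>v z) $ i = (\<Sum>j<n. if i = j then d j * z $ j else 0)"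
        using that z by (simp add: mat_diag_def scalar_prod_def atLeast0LessThan if_distrib[of "\<lambda>t. t * _"] cong: if_cong)
      then show ?thesis using that by simp
    qed
    then show ?thesis using z by (simp add: scalar_prod_def atLeast0LessThan mat_diag_def mult.left_commute)
  qed
  finally have xE: "x \<bullet> (E *\<^sub>v x) = (\<Sum>i<n. d i * (z $ i * z $ i))" .
  show ?thesis unfolding xx xE sum_distrib_left
    by (intro sum_mono mult_right_mono) (use min in auto)
qed

lemma min_eigenvalue_sesq_form:
  assumes E: "E \<in> carrier_mat n n" "E\<^sup>T = E" and v: "v \<in> carrier_vec n"
  shows "min_eigenvalue E * (eucl_norm v)\<^sup>2 \<le> Re (sesq_form E v v)"
proof -
  have "(eucl_norm v)\<^sup>2 = Re (sesq_form (1\<^sub>m n) v v)" using sesq_form_one[OF v] by simp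
  also have "\<dots> = map_vec Re v \<bullet> map_vec Re v + map_vec Im v \<bullet> map_vec Im v"
    using sesq_form_Re[OF one_carrier_mat v] v by simp
  finally have norm: "(eucl_norm v)\<^sup>2 = map_vec Re v \<bullet> map_vec Re v + map_vec Im v \<bullet> map_vec Im v" .
  show ?thesis
    unfolding norm sesq_form_Re[OF E(1) v] distrib_left
    by (intro add_mono min_eigenvalue_quadratic_form[OF E]) (use v in auto)
qed

section \<open>Square roots of positive definite matrices\<close>

lemma mat_inverse_of_injective:
  fixes X :: "real mat"
  assumes X: "X \<in> carrier_mat n n" and inj: "\<And>x. x \<in> carrier_vec n \<Longrightarrow> X *\<^sub>v x = 0\<^sub>v n \<Longrightarrow> x = 0\<^sub>v n"
  shows "the (mat_inverse X) \<in> carrier_mat n n" "the (mat_inverse X) * X = 1\<^sub>m n"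
    "X * the (mat_inverse X) = 1\<^sub>m n"
proof -
  have "det X \<noteq> 0" using inj det_0_iff_vec_prod_zero_field[OF X] by auto
  then have "mat_inverse X \<noteq> None"
    using mat_inverse(1)[OF X, of "()"] det_non_zero_imp_unit[OF X, of "()"] by auto
  then obtain Y where "mat_inverse X = Some Y" by auto
  then show "the (mat_inverse X) \<in> carrier_mat n n" "the (mat_inverse X) * X = 1\<^sub>m n"
    "X * the (mat_inverse X) = 1\<^sub>m n" using mat_inverse(2)[OF X] by auto
qed

lemma sym_pos_defD:
  assumes "sym_pos_def S" "S \<in> carrier_mat n n"
  shows "S\<^sup>T = S" "\<And>x. x \<in> carrier_vec n \<Longrightarrow> x \<noteq> 0\<^sub>v n \<Longrightarrow> x \<bullet> (S *\<^sub>v x) > 0"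
    "\<And>x. x \<in> carrier_vec n \<Longrightarrow> x \<bullet> (S *\<^sub>v x) \<ge> 0"
proof -
  show "S\<^sup>T = S" and pos: "\<And>x. x \<in> carrier_vec n \<Longrightarrow> x \<noteq> 0\<^sub>v n \<Longrightarrow> x \<bullet> (S *\<^sub>v x) > 0"
    using assms by (auto simp: sym_pos_def_def)
  show "x \<bullet> (S *\<^sub>v x) \<ge> 0" if "x \<in> carrier_vec n" for x
    using pos[OF that] that assms(2) by (cases "x = 0\<^sub>v n") auto
qed

lemma sym_pos_defI:
  assumes "S \<in> carrier_mat n n" "S\<^sup>T = S" "\<And>x. x \<in> carrier_vec n \<Longrightarrow> x \<noteq> 0\<^sub>v n \<Longrightarrow> x \<bullet> (S *\<^sub>v x) > 0"
  shows "sym_pos_def S"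
  using assms by (auto simp: sym_pos_def_def)

text \<open>With \<open>Z = X - Y\<close> the equation \<open>X\<^sup>2 = Y\<^sup>2\<close> reads \<open>X Z + Z Y = 0\<close>. Tested with an eigenvector \<open>q\<close> of
the symmetric matrix \<open>Z\<close> for the eigenvalue \<open>d\<close>, it gives \<open>d (q \<bullet> X q + q \<bullet> Y q) = 0\<close>, so \<open>d = 0\<close>.
All eigenvalues of \<open>Z\<close> vanish, and \<open>Z\<close> is diagonalizable.\<close>

lemma pos_def_sqrt_unique:
  assumes X: "sym_pos_def X" "X \<in> carrier_mat n n" and Y: "sym_pos_def Y" "Y \<in> carrier_mat n n"
    and eq: "X * X = Y * Y"
  shows "X = Y"
proof -
  define Z where "Z = X - Y"
  have Z: "Z \<in> carrier_mat n n" "Z\<^sup>T = Z"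
    using X(2) Y(2) sym_pos_defD(1)[OF X] sym_pos_defD(1)[OF Y]
    by (auto simp: Z_def transpose_minus[of _ n n])
  obtain Q d where Q: "Q \<in> carrier_mat n n" "Q\<^sup>T * Q = 1\<^sub>m n" "Q * Q\<^sup>T = 1\<^sub>m n"
    "Z = Q * mat_diag n d * Q\<^sup>T"
    "\<And>i. i < n \<Longrightarrow> Z *\<^sub>v col Q i = d i \<cdot>\<^sub>v col Q i"
    "\<And>i. i < n \<Longrightarrow> col Q i \<bullet> col Q i = 1"
    by (rule symmetric_eigenbasis[OF Z]) auto
  have "d i = 0" if i: "i < n" for i
  proof -
    define q where "q = col Q i"
    have q: "q \<in> carrier_vec n" "q \<noteq> 0\<^sub>v n" using Q(1) Q(6)[OF i] i by (auto simp: q_def)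
    have Xq: "X *\<^sub>v q \<in> carrier_vec n" and Yq: "Y *\<^sub>v q \<in> carrier_vec n" using X Y q by auto
    have Zq: "Z *\<^sub>v q = d i \<cdot>\<^sub>v q" using Q(5)[OF i] by (simp add: q_def)
    have Zv: "Z *\<^sub>v x = X *\<^sub>v x - Y *\<^sub>v x" if "x \<in> carrier_vec n" for x
      unfolding Z_def using X(2) Y(2) that by (simp add: minus_mult_distrib_mat_vec)
    have "X *\<^sub>v (Z *\<^sub>v q) = (X * X) *\<^sub>v q - X *\<^sub>v (Y *\<^sub>v q)"
      using X(2) Y(2) q Xq Yq Zv[OF q(1)] by (simp add: mult_minus_distrib_mat_vec[of _ n n])
    moreover have "Z *\<^sub>v (Y *\<^sub>v q) = X *\<^sub>v (Y *\<^sub>v q) - (X * X) *\<^sub>v q"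
      unfolding eq using X(2) Y(2) q Xq Yq Zv[OF Yq] by simp
    ultimately have "q \<bullet> (X *\<^sub>v (Z *\<^sub>v q)) + q \<bullet> (Z *\<^sub>v (Y *\<^sub>v q)) = 0"
      using q X Y Xq Yq by (simp add: scalar_prod_minus_distrib[of _ n])
    moreover have "q \<bullet> (X *\<^sub>v (Z *\<^sub>v q)) = d i * (q \<bullet> (X *\<^sub>v q))"
      unfolding Zq using X(2) q Xq by (simp add: mult_mat_vec[of _ n n])
    moreover have "q \<bullet> (Z *\<^sub>v (Y *\<^sub>v q)) = d i * (q \<bullet> (Y *\<^sub>v q))"
      using scalar_prod_transpose[OF Z(1) q(1) Yq] q Yq by (simp add: Z(2) Zq)
    ultimately have "d i * (q \<bullet> (X *\<^sub>v q) + q \<bullet> (Y *\<^sub>v q)) = 0" by (simp add: algebra_simps)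
    moreover have "q \<bullet> (X *\<^sub>v q) + q \<bullet> (Y *\<^sub>v q) > 0"
      using sym_pos_defD(2)[OF X q] sym_pos_defD(2)[OF Y q] by simp
    ultimately show ?thesis by simp
  qed
  then have "mat_diag n d = 0\<^sub>m n n" by (auto simp: mat_diag_def intro!: eq_matI)
  then have "X - Y = 0\<^sub>m n n" using Q by (simp add: Z_def)
  then have "(X - Y) $$ (i, j) = 0" if "i < n" "j < n" for i j using that by simp
  then show ?thesis using X(2) Y(2) by (intro eq_matI) fastforce+
qed

lemma pos_def_sqrt_exists:
  assumes S: "sym_pos_def S" "S \<in> carrier_mat n n"
  obtains X where "X \<in> carrier_mat n n" "sym_pos_def X" "X * X = S"
proof -
  obtain Q d where Q: "Q \<in> carrier_mat n n" "Q\<^sup>T * Q = 1\<^sub>m n" "Q * Q\<^sup>T = 1\<^sub>m n"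
    "S = Q * mat_diag n d * Q\<^sup>T"
    "\<And>i. i < n \<Longrightarrow> S *\<^sub>v col Q i = d i \<cdot>\<^sub>v col Q i"
    "\<And>i. i < n \<Longrightarrow> col Q i \<bullet> col Q i = 1"
    by (rule symmetric_eigenbasis[OF S(2) sym_pos_defD(1)[OF S]]) auto
  have d: "d i > 0" if i: "i < n" for i
  proof -
    have "col Q i \<in> carrier_vec n" "col Q i \<noteq> 0\<^sub>v n" using Q(1) Q(6)[OF i] i by auto
    from sym_pos_defD(2)[OF S this] show ?thesis using Q(1) Q(5,6)[OF i] i by simp
  qed
  note assoc = assoc_mult_mat[of _ n n _ n _ n]
  let ?D = "\<lambda>f. mat_diag n (\<lambda>i. f (d i))"
  have DT: "(mat_diag n f)\<^sup>T = mat_diag n f" for f :: "nat \<Rightarrow> real"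
    by (rule eq_matI) (auto simp: mat_diag_def)
  \<comment> \<open>The fourth root \<open>Y\<close> is symmetric with \<open>X = Y * Y\<close>, so that \<open>x \<bullet> X x\<close> is the square \<open>Y x \<bullet> Y x\<close>.\<close>
  define Y where "Y = Q * ?D (\<lambda>t. sqrt (sqrt t)) * Q\<^sup>T"
  define X where "X = Q * ?D sqrt * Q\<^sup>T"
  have Y: "Y \<in> carrier_mat n n" and X: "X \<in> carrier_mat n n"
    using Q(1) by (auto simp: X_def Y_def)
  have YT: "Y\<^sup>T = Y" and XT: "X\<^sup>T = X"
    using Q(1) by (simp_all add: X_def Y_def transpose_mult[of _ n n _ n] DT)
      (simp_all add: assoc)
  have sandwich: "(Q * mat_diag n f * Q\<^sup>T) * (Q * mat_diag n g * Q\<^sup>T)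
      = Q * mat_diag n (\<lambda>i. f i * g i) * Q\<^sup>T" for f g
  proof -
    have "(Q * mat_diag n f * Q\<^sup>T) * (Q * mat_diag n g * Q\<^sup>T)
        = Q * mat_diag n f * (Q\<^sup>T * Q) * (mat_diag n g * Q\<^sup>T)"
      using Q(1) by (simp add: assoc mult_carrier_mat[of _ n n _ n])
    also have "\<dots> = Q * (mat_diag n f * mat_diag n g) * Q\<^sup>T"
      using Q(1,2) by (simp add: assoc mult_carrier_mat[of _ n n _ n] left_mult_one_mat[of _ n n] del: mat_diag_diag)
    finally show ?thesis by simp
  qed
  have diag_cong: "mat_diag n f = mat_diag n g" if "\<And>i. i < n \<Longrightarrow> f i = g i" for f g :: "nat \<Rightarrow> real"
    using that by (auto simp: mat_diag_def intro!: eq_matI)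
  have "mat_diag n (\<lambda>i. sqrt (d i) * sqrt (d i)) = mat_diag n d"
    by (rule diag_cong) (use d in \<open>simp add: less_imp_le\<close>)
  then have XX: "X * X = S" by (simp add: X_def sandwich Q(4))
  have "mat_diag n (\<lambda>i. sqrt (sqrt (d i)) * sqrt (sqrt (d i))) = mat_diag n (\<lambda>i. sqrt (d i))"
    by (rule diag_cong) (use d in \<open>simp add: less_imp_le\<close>)
  then have YY: "Y * Y = X" by (simp add: X_def Y_def sandwich)
  have "sym_pos_def X"
  proof (rule sym_pos_defI[OF X XT])
    fix x :: "real vec" assume x: "x \<in> carrier_vec n" "x \<noteq> 0\<^sub>v n"
    have Yx: "Y *\<^sub>v x \<in> carrier_vec n" using Y x by simp
    have Xx: "X *\<^sub>v x = Y *\<^sub>v (Y *\<^sub>v x)"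
      unfolding YY[symmetric] by (rule assoc_mult_mat_vec[OF Y Y x(1)])
    have "S *\<^sub>v x = X *\<^sub>v (X *\<^sub>v x)"
      unfolding XX[symmetric] by (rule assoc_mult_mat_vec[OF X X x(1)])
    moreover have "S *\<^sub>v x \<noteq> 0\<^sub>v n"
      using sym_pos_defD(2)[OF S x] x by auto
    moreover have "M *\<^sub>v 0\<^sub>v n = 0\<^sub>v n" if "M \<in> carrier_mat n n" for M :: "real mat"
      using that by (intro eq_vecI) auto
    ultimately have "Y *\<^sub>v x \<noteq> 0\<^sub>v n" using X Y unfolding Xx by auto
    then have "(Y *\<^sub>v x) \<bullet> (Y *\<^sub>v x) > 0"
      using conjugate_square_greater_0_vec[OF Yx] by (simp add: conjugate_vec_def vec_eq_iff)
    also have "(Y *\<^sub>v x) \<bullet> (Y *\<^sub>v x) = x \<bullet> (X *\<^sub>v x)"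
      using scalar_prod_transpose[OF Y x(1) Yx] by (simp add: YT Xx)
    finally show "x \<bullet> (X *\<^sub>v x) > 0" .
  qed
  with X XX that show ?thesis by blast
qed

lemma sqrt_mat_eqI:
  assumes "X \<in> carrier_mat n n" "sym_pos_def X" "X * X = S"
  shows "sqrt_mat S = X"
  unfolding sqrt_mat_def
proof (rule the_equality)
  fix Y assume Y: "sym_pos_def Y \<and> Y * Y = S"
  then have "dim_row Y = n"
    using assms by (metis carrier_matD(1) index_mult_mat(2))
  then have "Y \<in> carrier_mat n n" using Y by (auto simp: sym_pos_def_def)
  with Y assms show "Y = X" by (intro pos_def_sqrt_unique[of Y n X]) auto
qed (use assms in auto)

lemma sqrt_mat:
  assumes S: "sym_pos_def S" "S \<in> carrier_mat n n"
  shows "sqrt_mat S \<in> carrier_mat n n" "sym_pos_def (sqrt_mat S)" "sqrt_mat S * sqrt_mat S = S"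
  using pos_def_sqrt_exists[OF S] sqrt_mat_eqI by metis+

lemma inv_sqrt_mat:
  assumes S: "sym_pos_def S" "S \<in> carrier_mat n n"
  shows "inv_sqrt_mat S \<in> carrier_mat n n" "inv_sqrt_mat S * sqrt_mat S = 1\<^sub>m n"
    "sqrt_mat S * inv_sqrt_mat S = 1\<^sub>m n" "(inv_sqrt_mat S)\<^sup>T = inv_sqrt_mat S"
proof -
  let ?X = "sqrt_mat S" and ?Q = "inv_sqrt_mat S"
  note X = sqrt_mat[OF S]
  have "x = 0\<^sub>v n" if "x \<in> carrier_vec n" "?X *\<^sub>v x = 0\<^sub>v n" for x
    using sym_pos_defD(2)[OF X(2,1) that(1)] that by auto
  note inv = mat_inverse_of_injective[OF X(1) this, folded inv_sqrt_mat_def]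
  from inv show Q: "?Q \<in> carrier_mat n n" and QX: "?Q * ?X = 1\<^sub>m n" and XQ: "?X * ?Q = 1\<^sub>m n" by auto
  have "?Q\<^sup>T * ?X = (?X * ?Q)\<^sup>T"
    using Q X(1) sym_pos_defD(1)[OF X(2,1)] by (simp add: transpose_mult[of _ n n _ n])
  then have "?Q\<^sup>T * ?X = 1\<^sub>m n" by (simp add: XQ)
  moreover have "?Q\<^sup>T = (?Q\<^sup>T * ?X) * ?Q"
    using Q X(1) XQ by (simp add: assoc_mult_mat[of _ n n _ n _ n])
  ultimately show "?Q\<^sup>T = ?Q" using Q by simp
qed

section \<open>Definite forms and full row rank on complex vectors\<close>

lemma sesq_form_semidef_nonneg:
  assumes M: "sym_pos_semidef M" "M \<in> carrier_mat n n" and v: "v \<in> carrier_vec n"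
  shows "Re (sesq_form M v v) \<ge> 0"
  using M v by (auto simp: sesq_form_Re[OF M(2) v] sym_pos_semidef_def)

lemma sesq_form_pos_def_pos:
  assumes M: "sym_pos_def M" "M \<in> carrier_mat n n" and v: "v \<in> carrier_vec n" "v \<noteq> 0\<^sub>v n"
  shows "Re (sesq_form M v v) > 0"
proof -
  let ?x = "map_vec Re v" and ?y = "map_vec Im v"
  have xy: "?x \<in> carrier_vec n" "?y \<in> carrier_vec n" using v by auto
  have "?x \<noteq> 0\<^sub>v n \<or> ?y \<noteq> 0\<^sub>v n"
  proof (rule ccontr)
    assume "\<not> ?thesis"
    then have 0: "?x = 0\<^sub>v n" "?y = 0\<^sub>v n" by auto
    have "v $ i = 0" if "i < n" for i
      using arg_cong[OF 0(1), of "\<lambda>z. z $ i"] arg_cong[OF 0(2), of "\<lambda>z. z $ i"] that v(1)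
      by (simp add: complex_eq_iff)
    with v show False by (auto intro!: eq_vecI)
  qed
  with xy sym_pos_defD(2,3)[OF M] show ?thesis
    unfolding sesq_form_Re[OF M(2) v(1)] by (metis add_pos_nonneg add_nonneg_pos)
qed

text \<open>A vector in the kernel of \<open>B\<^sup>T\<close> is orthogonal to the columns of \<open>B\<close>, which span the whole space;
so it is orthogonal to itself.\<close>

lemma full_row_rank_transpose_injective:
  fixes B :: "real mat"
  assumes B: "B \<in> carrier_mat n m" and rank: "vec_space.rank n B = n"
    and z: "z \<in> carrier_vec n" "B\<^sup>T *\<^sub>v z = 0\<^sub>v m"
  shows "z = 0\<^sub>v n"
proof -
  interpret vec_space "TYPE(real)" n .
  let ?P = "\<lambda>T. T \<subseteq> set (cols B) \<and> lin_indpt T"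
  obtain T where T: "maximal T ?P" "finite T"
    using maximal_exists_superset[of "set (cols B)" ?P "{}"]
    by (metis (no_types, lifting) List.finite_set empty_subsetI finite.emptyI finite_lin_indpt2 empty_iff)
  have TP: "T \<subseteq> set (cols B)" "lin_indpt T" using T by (auto simp: maximal_def)
  have Tc: "T \<subseteq> carrier_vec n" using TP cols_dim B by blast
  have "card T = n" using rank_card_indpt[OF B T(1)] rank by simp
  then have "basis T"
    using TP Tc T(2) by (intro dim_li_is_basis) (auto simp: dim_is_n)
  then have "span T = carrier_vec n" by (simp add: basis_def)
  have zcol: "z \<bullet> c = 0" if c: "c \<in> set (cols B)" for c
  proof -
    obtain j where j: "j < m" "c = col B j" using c B by (auto simp: in_set_conv_nth)
    have "(B\<^sup>T *\<^sub>v z) $ j = c \<bullet> z" using j B by simp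
    then have "c \<bullet> z = 0" using z j by simp
    then show ?thesis using comm_scalar_prod[of c n z] j B z by auto
  qed
  have "submodule class_ring {v \<in> carrier_vec n. z \<bullet> v = 0} V"
    by (rule submodule.intro[OF module_axioms])
      (use z in \<open>auto simp: scalar_prod_add_distrib[of _ n] class_ring_simps module_vec_simps\<close>)
  then have "span T \<subseteq> {v \<in> carrier_vec n. z \<bullet> v = 0}"
    by (intro span_is_subset) (use TP Tc zcol in auto)
  then have "z \<bullet> z = 0" using z \<open>span T = carrier_vec n\<close> by auto
  then show ?thesis using conjugate_square_eq_0_vec[OF z(1)] by (simp add: conjugate_vec_def vec_eq_iff)
qed

text \<open>If \<open>B\<^sup>T z\<close> is orthogonal to every vector it vanishes, and since \<open>B\<close> is real, so do \<open>B\<^sup>T Re z\<close> and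
\<open>B\<^sup>T Im z\<close>.\<close>

lemma full_row_rank_sesq_form_injective:
  assumes B: "B \<in> carrier_mat n m" and rank: "vec_space.rank n B = n"
    and z: "z \<in> carrier_vec n" and orth: "\<And>x. x \<in> carrier_vec m \<Longrightarrow> sesq_form B\<^sup>T x z = 0"
  shows "z = 0\<^sub>v n"
proof -
  define t where "t = map_mat complex_of_real B\<^sup>T *\<^sub>v z"
  have t: "t \<in> carrier_vec m" using B z by (simp add: t_def)
  have "conjugate t \<bullet> t = 0" using orth[OF t] by (simp add: sesq_form_def t_def)
  then have t0: "t = 0\<^sub>v m"
    using conjugate_square_eq_0_vec[OF t] conjugate_vec_sprod_comm[OF t t] by simp
  have Re: "B\<^sup>T *\<^sub>v map_vec Re z = 0\<^sub>v m"
  proof (rule eq_vecI)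
    fix j assume "j < dim_vec (0\<^sub>v m :: real vec)"
    then show "(B\<^sup>T *\<^sub>v map_vec Re z) $ j = 0\<^sub>v m $ j"
      using arg_cong[OF t0, of "\<lambda>v. Re (v $ j)"] B z by (simp add: t_def scalar_prod_def)
  qed (use B in auto)
  have Im: "B\<^sup>T *\<^sub>v map_vec Im z = 0\<^sub>v m"
  proof (rule eq_vecI)
    fix j assume "j < dim_vec (0\<^sub>v m :: real vec)"
    then show "(B\<^sup>T *\<^sub>v map_vec Im z) $ j = 0\<^sub>v m $ j"
      using arg_cong[OF t0, of "\<lambda>v. Im (v $ j)"] B z by (simp add: t_def scalar_prod_def)
  qed (use B in auto)
  have 0: "map_vec Re z = 0\<^sub>v n" "map_vec Im z = 0\<^sub>v n"
    using full_row_rank_transpose_injective[OF B rank _ Re] full_row_rank_transpose_injective[OF B rank _ Im] z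
    by auto
  have "z $ i = 0" if "i < n" for i
    using arg_cong[OF 0(1), of "\<lambda>z. z $ i"] arg_cong[OF 0(2), of "\<lambda>z. z $ i"] that z
    by (simp add: complex_eq_iff)
  with z show ?thesis by (auto intro!: eq_vecI)
qed

section \<open>Block matrices\<close>

lemma block_start_Suc: "block_start n (Suc k) = block_start n k + n k"
  by (simp add: block_start_def)

lemma block_start_mono: "k \<le> l \<Longrightarrow> block_start n k \<le> block_start n l"
  unfolding block_start_def by (rule sum_mono2) auto

lemma block_start_add_less: "k \<le> N \<Longrightarrow> i < n k \<Longrightarrow> block_start n k + i < block_start n (Suc N)"
  using block_start_mono[of "Suc k" "Suc N" n] by (simp add: block_start_Suc)

lemma block_of_block_start:
  assumes "i < n k"
  shows "block_of n (block_start n k + i) = k"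
  unfolding block_of_def
proof (rule Least_equality)
  show "block_start n k + i < block_start n (Suc k)" using assms by (simp add: block_start_Suc)
  show "k \<le> l" if "block_start n k + i < block_start n (Suc l)" for l
    using that block_start_mono[of "Suc l" k n] by (rule_tac ccontr) auto
qed

lemma block_index:
  assumes "i < block_start n (Suc N)"
  obtains k j where "k \<le> N" "j < n k" "i = block_start n k + j"
proof -
  have "\<exists>k\<le>N. \<exists>j<n k. i = block_start n k + j" using assms
  proof (induction N)
    case 0
    then show ?case by (auto simp: block_start_def)
  next
    case (Suc N)
    show ?case
    proof (cases "i < block_start n (Suc N)")
      case True
      then show ?thesis using Suc.IH le_SucI by blast
    next
      case False
      then have "i = block_start n (Suc N) + (i - block_start n (Suc N))"
        "i - block_start n (Suc N) < n (Suc N)"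
        using Suc.prems by (auto simp: block_start_Suc)
      then show ?thesis by blast
    qed
  qed
  with that show ?thesis by blast
qed

lemma sum_blocks:
  fixes f :: "nat \<Rightarrow> 'a :: comm_monoid_add"
  shows "(\<Sum>i<block_start n K. f i) = (\<Sum>k<K. \<Sum>j<n k. f (block_start n k + j))"
proof (induction K)
  case 0
  show ?case by (simp add: block_start_def)
next
  case (Suc K)
  have split: "(\<Sum>i<a + b. f i) = (\<Sum>i<a. f i) + (\<Sum>j<b. f (a + j))" for a b
    by (induction b) (auto simp: add.assoc)
  show ?case unfolding block_start_Suc split Suc by simp
qed

lemma vec_block_carrier [simp]: "vec_block n v k \<in> carrier_vec (n k)"
  by (simp add: vec_block_def)

lemma vec_block_eqI:
  assumes "v \<in> carrier_vec (block_start n (Suc N))" "w \<in> carrier_vec (block_start n (Suc N))"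
    and "\<And>k. k \<le> N \<Longrightarrow> vec_block n v k = vec_block n w k"
  shows "v = w"
proof (rule eq_vecI)
  fix i assume "i < dim_vec w"
  then have "i < block_start n (Suc N)" using assms by simp
  then obtain k j where kj: "k \<le> N" "j < n k" "i = block_start n k + j" by (rule block_index)
  from arg_cong[OF assms(3)[OF kj(1)], of "\<lambda>x. x $ j"] kj show "v $ i = w $ i"
    by (simp add: vec_block_def)
qed (use assms in auto)

lemma scalar_prod_blocks:
  assumes "w \<in> carrier_vec (block_start n (Suc N))"
  shows "v \<bullet> w = (\<Sum>k\<le>N. vec_block n v k \<bullet> vec_block n w k)"
  using assms
  by (simp add: scalar_prod_def atLeast0LessThan sum_blocks lessThan_Suc_atMost vec_block_def)

lemma block_mat_carrier [simp]:
  "block_mat n N F \<in> carrier_mat (block_start n (Suc N)) (block_start n (Suc N))"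
  by (simp add: block_mat_def)

lemma block_mat_index:
  assumes "k \<le> N" "l \<le> N" "i < n k" "j < n l"
  shows "block_mat n N F $$ (block_start n k + i, block_start n l + j) = F k l $$ (i, j)"
  using assms by (simp add: block_mat_def block_start_add_less block_of_block_start)

lemma block_mat_eqI:
  assumes "M \<in> carrier_mat (block_start n (Suc N)) (block_start n (Suc N))"
    and "\<And>k l i j. k \<le> N \<Longrightarrow> l \<le> N \<Longrightarrow> i < n k \<Longrightarrow> j < n l
      \<Longrightarrow> M $$ (block_start n k + i, block_start n l + j) = F k l $$ (i, j)"
  shows "M = block_mat n N F"
proof (rule eq_matI)
  fix i j assume "i < dim_row (block_mat n N F)" "j < dim_col (block_mat n N F)"
  then have "i < block_start n (Suc N)" "j < block_start n (Suc N)" by (auto simp: block_mat_def)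
  then show "M $$ (i, j) = block_mat n N F $$ (i, j)"
    by (elim block_index) (simp add: assms block_mat_index)
qed (use assms in \<open>auto simp: block_mat_def\<close>)

text \<open>Products of block matrices are computed through their action on vectors by this formula, which
avoids a block decomposition of the entries of a product.\<close>

lemma vec_block_mult_block_mat:
  fixes F :: "nat \<Rightarrow> nat \<Rightarrow> 'a :: comm_semiring_1 mat"
  assumes F: "\<And>l. l \<le> N \<Longrightarrow> F k l \<in> carrier_mat (n k) (n l)"
    and v: "v \<in> carrier_vec (block_start n (Suc N))" and k: "k \<le> N" and i: "i < n k"
  shows "vec_block n (block_mat n N F *\<^sub>v v) k $ i = (\<Sum>l\<le>N. (F k l *\<^sub>v vec_block n v l) $ i)"
proof -
  have ki: "block_start n k + i < block_start n (Suc N)" using k i by (rule block_start_add_less)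
  have "vec_block n (block_mat n N F *\<^sub>v v) k $ i
      = (\<Sum>m<block_start n (Suc N). block_mat n N F $$ (block_start n k + i, m) * v $ m)"
    using i ki v carrier_matD[OF block_mat_carrier[of n N F]]
    by (simp add: vec_block_def scalar_prod_def atLeast0LessThan)
  also have "\<dots> = (\<Sum>l\<le>N. \<Sum>j<n l. F k l $$ (i, j) * v $ (block_start n l + j))"
    unfolding sum_blocks lessThan_Suc_atMost
    by (intro sum.cong refl) (simp add: block_mat_index k i)
  also have "\<dots> = (\<Sum>l\<le>N. (F k l *\<^sub>v vec_block n v l) $ i)"
  proof (intro sum.cong refl)
    fix l assume "l \<in> {..N}"
    then have "F k l \<in> carrier_mat (n k) (n l)" using F by simp
    then show "(\<Sum>j<n l. F k l $$ (i, j) * v $ (block_start n l + j)) = (F k l *\<^sub>v vec_block n v l) $ i"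
      using i by (simp add: scalar_prod_def atLeast0LessThan vec_block_def)
  qed
  finally show ?thesis .
qed

lemma vec_block_mult_diag_blocks:
  fixes D :: "nat \<Rightarrow> 'a :: comm_semiring_1 mat"
  assumes D: "\<And>k. k \<le> N \<Longrightarrow> D k \<in> carrier_mat (n k) (n k)"
    and v: "v \<in> carrier_vec (block_start n (Suc N))" and k: "k \<le> N"
  shows "vec_block n (block_mat n N (\<lambda>k l. if k = l then D k else 0\<^sub>m (n k) (n l)) *\<^sub>v v) k
    = D k *\<^sub>v vec_block n v k"
proof (rule eq_vecI)
  fix i assume "i < dim_vec (D k *\<^sub>v vec_block n v k)"
  then have i: "i < n k" using D[OF k] by simp
  have "vec_block n (block_mat n N (\<lambda>k l. if k = l then D k else 0\<^sub>m (n k) (n l)) *\<^sub>v v) k $ i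
      = (\<Sum>l\<le>N. ((if k = l then D k else 0\<^sub>m (n k) (n l)) *\<^sub>v vec_block n v l) $ i)"
    by (rule vec_block_mult_block_mat) (use D v k i in auto)
  also have "\<dots> = (\<Sum>l\<le>N. if k = l then (D k *\<^sub>v vec_block n v k) $ i else 0)"
    by (intro sum.cong refl) (use i in \<open>auto simp: scalar_prod_def vec_block_def\<close>)
  finally show "vec_block n (block_mat n N (\<lambda>k l. if k = l then D k else 0\<^sub>m (n k) (n l)) *\<^sub>v v) k $ i
      = (D k *\<^sub>v vec_block n v k) $ i"
    using k by simp
qed (use D[OF k] in \<open>auto simp: vec_block_def\<close>)

lemmas vec_block_mult_block_diag = vec_block_mult_diag_blocks[where 'a = real, folded block_diag_mat_def]

lemma block_diag_carrier [simp]: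
  "block_diag_mat n N D \<in> carrier_mat (block_start n (Suc N)) (block_start n (Suc N))"
  by (simp add: block_diag_mat_def)

lemma block_diag_sym_pos_def:
  assumes D: "\<And>k. k \<le> N \<Longrightarrow> D k \<in> carrier_mat (n k) (n k)" "\<And>k. k \<le> N \<Longrightarrow> sym_pos_def (D k)"
  shows "sym_pos_def (block_diag_mat n N D)"
proof (rule sym_pos_defI)
  show "(block_diag_mat n N D)\<^sup>T = block_diag_mat n N D"
    unfolding block_diag_mat_def
  proof (rule block_mat_eqI)
    fix k l i j assume kl: "k \<le> N" "l \<le> N" "i < n k" "j < n l"
    have "D k $$ (i, j) = D k $$ (j, i)" if "k = l"
      using arg_cong[OF sym_pos_defD(1)[OF D(2)[OF kl(1)] D(1)[OF kl(1)]], of "\<lambda>M. M $$ (i, j)"]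
        D(1)[OF kl(1)] kl that by simp
    then show "(block_mat n N (\<lambda>k l. if k = l then D k else 0\<^sub>m (n k) (n l)))\<^sup>T
        $$ (block_start n k + i, block_start n l + j) = (if k = l then D k else 0\<^sub>m (n k) (n l)) $$ (i, j)"
      using kl block_start_add_less[of k N i n] block_start_add_less[of l N j n]
        carrier_matD[OF block_mat_carrier[of n N "\<lambda>k l. if k = l then D k else 0\<^sub>m (n k) (n l)"]]
      by (auto simp: block_mat_index)
  qed simp
next
  fix x :: "real vec" assume x: "x \<in> carrier_vec (block_start n (Suc N))" "x \<noteq> 0\<^sub>v (block_start n (Suc N))"
  obtain k where k: "k \<le> N" "vec_block n x k \<noteq> 0\<^sub>v (n k)"
  proof -
    have "x = 0\<^sub>v (block_start n (Suc N))" if "\<And>k. k \<le> N \<Longrightarrow> vec_block n x k = 0\<^sub>v (n k)"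
      by (rule vec_block_eqI) (use x that block_start_add_less in \<open>auto simp: vec_block_def intro!: eq_vecI\<close>)
    with x that show ?thesis by blast
  qed
  have "x \<bullet> (block_diag_mat n N D *\<^sub>v x) = (\<Sum>k\<le>N. vec_block n x k \<bullet> (D k *\<^sub>v vec_block n x k))"
    using scalar_prod_blocks[OF mult_mat_vec_carrier[OF block_diag_carrier x(1)]]
    by (simp add: vec_block_mult_block_diag[OF D(1) x(1)])
  also have "\<dots> > 0"
    by (rule sum_pos2[of _ k])
      (use k sym_pos_defD(2,3)[OF D(2,1)] in auto)
  finally show "x \<bullet> (block_diag_mat n N D *\<^sub>v x) > 0" .
qed simp

lemma mat_eqI_mult_vec:
  fixes A B :: "'a :: semiring_1 mat"
  assumes A: "A \<in> carrier_mat n m" and B: "B \<in> carrier_mat n m"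
    and eq: "\<And>v. v \<in> carrier_vec m \<Longrightarrow> A *\<^sub>v v = B *\<^sub>v v"
  shows "A = B"
proof (rule eq_matI)
  fix i j assume "i < dim_row B" "j < dim_col B"
  then show "A $$ (i, j) = B $$ (i, j)"
    using arg_cong[OF eq[of "unit_vec m j"], of "\<lambda>v. v $ i"] A B by simp
qed (use A B in auto)

lemma block_diag_mult:
  assumes D: "\<And>k. k \<le> N \<Longrightarrow> D k \<in> carrier_mat (n k) (n k)"
    and E: "\<And>k. k \<le> N \<Longrightarrow> E k \<in> carrier_mat (n k) (n k)"
  shows "block_diag_mat n N D * block_diag_mat n N E = block_diag_mat n N (\<lambda>k. D k * E k)"
proof (rule mat_eqI_mult_vec)
  let ?m = "block_start n (Suc N)"
  show "block_diag_mat n N D * block_diag_mat n N E \<in> carrier_mat ?m ?m"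
    using block_diag_carrier by (rule mult_carrier_mat) simp
  fix v :: "real vec" assume v: "v \<in> carrier_vec ?m"
  have Ev: "block_diag_mat n N E *\<^sub>v v \<in> carrier_vec ?m" using v by (intro mult_mat_vec_carrier[OF block_diag_carrier])
  have assoc: "(block_diag_mat n N D * block_diag_mat n N E) *\<^sub>v v
    = block_diag_mat n N D *\<^sub>v (block_diag_mat n N E *\<^sub>v v)"
    by (rule assoc_mult_mat_vec[OF block_diag_carrier block_diag_carrier v])
  show "(block_diag_mat n N D * block_diag_mat n N E) *\<^sub>v v = block_diag_mat n N (\<lambda>k. D k * E k) *\<^sub>v v"
    unfolding assoc
  proof (rule vec_block_eqI)
    fix k assume k: "k \<le> N"
    show "vec_block n (block_diag_mat n N D *\<^sub>v (block_diag_mat n N E *\<^sub>v v)) k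
        = vec_block n (block_diag_mat n N (\<lambda>k. D k * E k) *\<^sub>v v) k"
    proof -
      have DE: "D k * E k \<in> carrier_mat (n k) (n k)" if "k \<le> N" for k
        using D[OF that] E[OF that] by simp
      have "vec_block n (block_diag_mat n N D *\<^sub>v (block_diag_mat n N E *\<^sub>v v)) k
          = D k *\<^sub>v (E k *\<^sub>v vec_block n v k)"
        by (simp only: vec_block_mult_block_diag[OF D Ev k] vec_block_mult_block_diag[OF E v k])
      also have "\<dots> = (D k * E k) *\<^sub>v vec_block n v k"
        by (rule assoc_mult_mat_vec[OF D[OF k] E[OF k] vec_block_carrier[of n v k], symmetric])
      also have "\<dots> = vec_block n (block_diag_mat n N (\<lambda>k. D k * E k) *\<^sub>v v) k"
        by (rule vec_block_mult_block_diag[OF DE v k, symmetric])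
      finally show ?thesis .
    qed
  qed (use v Ev in \<open>auto intro!: mult_mat_vec_carrier[OF block_diag_carrier]\<close>)
qed (auto)

text \<open>The block diagonal matrix of the square roots is positive definite and has the right square, so it
is the square root by uniqueness.\<close>

lemma sqrt_mat_block_diag:
  assumes S: "\<And>k. k \<le> N \<Longrightarrow> S k \<in> carrier_mat (n k) (n k)" "\<And>k. k \<le> N \<Longrightarrow> sym_pos_def (S k)"
  shows "sqrt_mat (block_diag_mat n N S) = block_diag_mat n N (\<lambda>k. sqrt_mat (S k))"
proof (rule sqrt_mat_eqI)
  note X = sqrt_mat[OF S(2,1)]
  show "sym_pos_def (block_diag_mat n N (\<lambda>k. sqrt_mat (S k)))"
    by (intro block_diag_sym_pos_def) (use X in auto)
  show "block_diag_mat n N (\<lambda>k. sqrt_mat (S k)) \<in> carrier_mat (block_start n (Suc N)) (block_start n (Suc N))"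
    by simp
  have "block_diag_mat n N (\<lambda>k. sqrt_mat (S k)) * block_diag_mat n N (\<lambda>k. sqrt_mat (S k))
      = block_diag_mat n N (\<lambda>k. sqrt_mat (S k) * sqrt_mat (S k))"
    by (intro block_diag_mult) (use X in auto)
  also have "\<dots> = block_diag_mat n N S"
    unfolding block_diag_mat_def by (rule block_mat_eqI) (auto simp: block_mat_index X)
  finally show "block_diag_mat n N (\<lambda>k. sqrt_mat (S k)) * block_diag_mat n N (\<lambda>k. sqrt_mat (S k))
      = block_diag_mat n N S" .
qed

lemma map_mat_block_mat:
  assumes "\<And>k l. k \<le> N \<Longrightarrow> l \<le> N \<Longrightarrow> F k l \<in> carrier_mat (n k) (n l)"
  shows "map_mat f (block_mat n N F) = block_mat n N (\<lambda>k l. map_mat f (F k l))"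
proof (rule block_mat_eqI)
  fix k l i j assume kl: "k \<le> N" "l \<le> N" "i < n k" "j < n l"
  show "map_mat f (block_mat n N F) $$ (block_start n k + i, block_start n l + j)
      = map_mat f (F k l) $$ (i, j)"
    using kl assms[OF kl(1,2)] block_start_add_less[of k N i n] block_start_add_less[of l N j n]
      carrier_matD[OF block_mat_carrier[of n N F]] by (auto simp: block_mat_index)
qed simp

lemma vec_block_mult_complex_block_diag:
  assumes D: "\<And>k. k \<le> N \<Longrightarrow> D k \<in> carrier_mat (n k) (n k)"
    and v: "v \<in> carrier_vec (block_start n (Suc N))" and k: "k \<le> N"
  shows "vec_block n (map_mat complex_of_real (block_diag_mat n N D) *\<^sub>v v) k
    = map_mat complex_of_real (D k) *\<^sub>v vec_block n v k"
proof -
  have "map_mat complex_of_real (block_diag_mat n N D) = block_mat n N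
      (\<lambda>k l. map_mat complex_of_real (if k = l then D k else 0\<^sub>m (n k) (n l)))"
    unfolding block_diag_mat_def by (rule map_mat_block_mat) (use D in auto)
  also have "\<dots> = block_mat n N
      (\<lambda>k l. if k = l then map_mat complex_of_real (D k) else 0\<^sub>m (n k) (n l))"
    by (intro arg_cong[of _ _ "block_mat n N"] ext) (auto intro!: eq_matI)
  finally show ?thesis using D v k by (simp add: vec_block_mult_diag_blocks)
qed

lemma sesq_form_block_row:
  assumes F: "\<And>k l. k \<le> N \<Longrightarrow> l \<le> N \<Longrightarrow> F k l \<in> carrier_mat (n k) (n l)"
    and y: "y \<in> carrier_vec (block_start n (Suc N))" and k: "k \<le> N" and x: "x \<in> carrier_vec (n k)"
  shows "conjugate x \<bullet> vec_block n (map_mat complex_of_real (block_mat n N F) *\<^sub>v y) k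
    = (\<Sum>l\<le>N. sesq_form (F k l) x (vec_block n y l))"
proof -
  let ?G = "\<lambda>k l. map_mat complex_of_real (F k l)"
  have "conjugate x \<bullet> vec_block n (block_mat n N ?G *\<^sub>v y) k
      = (\<Sum>i<n k. conjugate x $ i * (\<Sum>l\<le>N. (?G k l *\<^sub>v vec_block n y l) $ i))"
  proof -
    have "vec_block n (block_mat n N ?G *\<^sub>v y) k $ i = (\<Sum>l\<le>N. (?G k l *\<^sub>v vec_block n y l) $ i)"
      if "i < n k" for i
      by (rule vec_block_mult_block_mat) (use F y k that in auto)
    then show ?thesis by (simp add: scalar_prod_def atLeast0LessThan vec_block_def[of _ _ k])
  qed
  also have "\<dots> = (\<Sum>l\<le>N. \<Sum>i<n k. conjugate x $ i * (?G k l *\<^sub>v vec_block n y l) $ i)"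
    unfolding sum_distrib_left by (rule sum.swap)
  also have "\<dots> = (\<Sum>l\<le>N. sesq_form (F k l) x (vec_block n y l))"
  proof (rule sum.cong[OF refl])
    fix l assume "l \<in> {..N}"
    then have "F k l \<in> carrier_mat (n k) (n l)" using F k by simp
    then show "(\<Sum>i<n k. conjugate x $ i * (?G k l *\<^sub>v vec_block n y l) $ i) = sesq_form (F k l) x (vec_block n y l)"
      by (auto simp: sesq_form_def scalar_prod_def atLeast0LessThan)
  qed
  finally show ?thesis by (simp add: map_mat_block_mat F)
qed

section \<open>Elimination of the couplings\<close>

text \<open>The heart of the matter, a statement about numbers only. The hypothesis \<open>row\<close> is the \<open>k\<close>-th block
row of the eigenvalue equation tested with the \<open>k\<close>-th block of the eigenvector, where \<open>p\<close> collects
the coupling terms, \<open>w\<close> the squared norms and \<open>e\<close> the energies of the diagonal blocks.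

Put \<open>r = |\<mu>|\<^sup>2\<close>. The couplings telescope if the row \<open>2 j\<close> is weighted by \<open>r\<^sup>j\<close> and the conjugate of
the row \<open>2 j + 1\<close> by \<open>- \<mu> r\<^sup>j\<close>: the remainder \<open>- r\<^sup>j p\<^sub>2\<^sub>j\<close> of the earlier rows becomes \<open>\<mu> r\<^sup>j cnj p\<^sub>2\<^sub>j\<^sub>+\<^sub>1\<close>
after the row \<open>2 j\<close>, and then \<open>- r\<^sup>j\<^sup>+\<^sup>1 p\<^sub>2\<^sub>j\<^sub>+\<^sub>2\<close> because \<open>\<mu> cnj \<mu> = r\<close>. What remains at
the end is one complex equation without couplings. Because the imaginary part of \<open>\<mu>\<close> is not zero, its imaginary and real parts say, for the weighted sums \<open>W\<^sub>e\<close>,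
\<open>W\<^sub>o\<close> of the norms and \<open>E\<^sub>e\<close>, \<open>E\<^sub>o\<close> of the energies over even and odd indices,
\<open>W\<^sub>e + E\<^sub>o = W\<^sub>o\<close> and \<open>W\<^sub>e - E\<^sub>e = r W\<^sub>o\<close>. Hence \<open>E\<^sub>e + E\<^sub>o = (1 - r) W\<^sub>o\<close>. The left hand side contains
\<open>e\<^sub>0 + e\<^sub>1\<close> with weight one and is positive, so \<open>r < 1\<close>; then the weights are at most one and
\<open>W\<^sub>o \<le> 1 - w\<^sub>0 < 1\<close>.\<close>

lemma complex_coupling_bound:
  fixes w e :: "nat \<Rightarrow> real" and p :: "nat \<Rightarrow> complex" and \<mu> :: complex
  assumes p0: "p 0 = 0" and pN: "p (Suc N) = 0"
    and row: "\<And>k. k \<le> N \<Longrightarrow> p k + \<mu> * cnj (p (Suc k)) = (1 + \<mu>) * of_real (w k) - of_real (e k)"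
    and Im: "Im \<mu> \<noteq> 0" and N: "N \<ge> 1"
    and w: "\<And>k. k \<le> N \<Longrightarrow> w k \<ge> 0" "w 0 > 0" "(\<Sum>k\<le>N. w k) = 1"
    and e: "\<And>k. k \<le> N \<Longrightarrow> e k \<ge> 0" "e 0 > 0"
  shows "e 0 + e 1 < 1 - (cmod \<mu>)\<^sup>2"
proof -
  define r where "r = (cmod \<mu>)\<^sup>2"
  have r: "\<mu> * cnj \<mu> = of_real r" by (simp add: r_def flip: complex_norm_square)
  have r_parts: "r = Re \<mu> * Re \<mu> + Im \<mu> * Im \<mu>"
    unfolding r_def cmod_power2 by (simp add: power2_eq_square)
  have r0: "r \<ge> 0" by (simp add: r_def)
  define \<theta> where "\<theta> k = r ^ (k div 2)" for k :: nat
  have \<theta>0: "\<theta> k \<ge> 0" for k using r0 by (simp add: \<theta>_def)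
  define \<rho> where "\<rho> k = (1 + \<mu>) * of_real (w k) - of_real (e k)" for k
  define \<tau> where "\<tau> k = of_real (\<theta> k) * (if even k then \<rho> k else - \<mu> * cnj (\<rho> k))" for k
  \<comment> \<open>The coupling that is left over after the first \<open>K\<close> weighted rows.\<close>
  have "K \<le> Suc N \<Longrightarrow> (\<Sum>k<K. \<tau> k) = of_real (\<theta> K) * (if even K then - p K else \<mu> * cnj (p K))" for K
  proof (induction K)
    case 0
    show ?case by (simp add: p0)
  next
    case (Suc K)
    have \<rho>: "\<rho> K = p K + \<mu> * cnj (p (Suc K))" using row[of K] Suc.prems by (simp add: \<rho>_def)
    show ?case
    proof (cases "even K")
      case True
      then have "\<theta> (Suc K) = \<theta> K" by (simp add: \<theta>_def)
      with True Suc show ?thesis by (simp add: \<tau>_def \<rho> algebra_simps)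
    next
      case False
      then have "\<theta> (Suc K) = r * \<theta> K" by (auto simp: \<theta>_def elim!: oddE)
      moreover have "\<mu> * cnj (\<rho> K) = \<mu> * cnj (p K) + of_real r * p (Suc K)"
        by (simp add: \<rho> algebra_simps flip: r)
      ultimately show ?thesis using False Suc by (simp add: \<tau>_def algebra_simps)
    qed
  qed
  from this[of "Suc N"] have sum0: "(\<Sum>k\<le>N. \<tau> k) = 0" by (simp add: pN lessThan_Suc_atMost)
  define a where "a k = \<theta> k * w k" for k
  define b where "b k = \<theta> k * e k" for k
  \<comment> \<open>The imaginary part of \<open>\<tau> k\<close> is \<open>Im \<mu> * c k\<close>, so the \<open>c k\<close> add up to zero; the real part contains
    \<open>Re \<mu> * c k\<close>, which therefore disappears from the sum.\<close>
  define c where "c k = (if even k then a k else b k - a k)" for k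
  have \<tau>Im: "Im (\<tau> k) = Im \<mu> * c k" for k
    by (simp add: \<tau>_def \<rho>_def a_def b_def c_def algebra_simps)
  have \<tau>Re: "Re (\<tau> k) = Re \<mu> * c k + (if even k then a k - b k else - r * a k)" for k
    by (simp add: \<tau>_def \<rho>_def a_def b_def c_def algebra_simps r_parts)
  have c0: "(\<Sum>k\<le>N. c k) = 0"
    using arg_cong[OF sum0, of Im] Im by (simp add: \<tau>Im flip: sum_distrib_left)
  have re0: "(\<Sum>k\<le>N. if even k then a k - b k else - r * a k) = 0"
    using arg_cong[OF sum0, of Re] c0 by (simp add: \<tau>Re sum.distrib flip: sum_distrib_left)
  define Wo where "Wo = (\<Sum>k\<le>N. if odd k then a k else 0)"
  have "(\<Sum>k\<le>N. b k) = (\<Sum>k\<le>N. c k - (if even k then a k - b k else - r * a k)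
      + (1 - r) * (if odd k then a k else 0))"
    by (intro sum.cong refl) (simp add: c_def algebra_simps)
  also have "\<dots> = (1 - r) * Wo"
    using c0 re0 by (simp add: Wo_def sum.distrib sum_subtractf flip: sum_distrib_left)
  finally have balance: "(\<Sum>k\<le>N. b k) = (1 - r) * Wo" .
  have "e 0 + e 1 = (\<Sum>k\<in>{0,1}. b k)" by (simp add: b_def \<theta>_def)
  also have "\<dots> \<le> (\<Sum>k\<le>N. b k)"
    by (rule sum_mono2) (use N e \<theta>0 in \<open>auto simp: b_def\<close>)
  finally have le: "e 0 + e 1 \<le> (1 - r) * Wo" using balance by simp
  have "Wo \<ge> 0" unfolding Wo_def by (rule sum_nonneg) (use w \<theta>0 in \<open>auto simp: a_def\<close>)
  moreover have "(1 - r) * Wo > 0" using le e(2) e(1)[OF N] by linarith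
  ultimately have r1: "r < 1" by (simp add: zero_less_mult_iff)
  have \<theta>1: "\<theta> k \<le> 1" for k using r0 r1 by (simp add: \<theta>_def power_le_one)
  have "Wo \<le> (\<Sum>k\<le>N. w k - (if k = 0 then w 0 else 0))"
    unfolding Wo_def
  proof (intro sum_mono)
    fix k assume "k \<in> {..N}"
    then have "a k \<le> w k" "w k \<ge> 0" using w \<theta>1[of k] by (auto simp: a_def mult_left_le_one_le \<theta>0)
    then show "(if odd k then a k else 0) \<le> w k - (if k = 0 then w 0 else 0)" by auto
  qed
  then have "Wo < 1" using w by (simp add: sum_subtractf)
  then have "(1 - r) * Wo < 1 - r" using r1 by simp
  with le show ?thesis by (simp add: r_def)
qed

section \<open>Nonreal eigenvalues of the preconditioned matrix\<close>

lemma sum_tridiagonal: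
  fixes a b c :: "nat \<Rightarrow> 'a :: comm_monoid_add"
  assumes "k \<le> N"
  shows "(\<Sum>l\<le>N. if k = l then a l else if k = Suc l then b l else if l = Suc k then c l else 0)
    = a k + (if 0 < k then b (k - 1) else 0) + (if k < N then c (Suc k) else 0)"
proof -
  have "(\<Sum>l\<le>N. if k = l then a l else if k = Suc l then b l else if l = Suc k then c l else 0)
      = (\<Sum>l\<le>N. (if l = k then a l else 0) + (if l = k - 1 then if 0 < k then b l else 0 else 0)
          + (if l = Suc k then c l else 0))"
    by (intro sum.cong refl) auto
  also have "\<dots> = a k + (if 0 < k then b (k - 1) else 0) + (if k < N then c (Suc k) else 0)"
    using assms le_trans[OF diff_le_self assms, of 1] by (simp add: sum.distrib Suc_le_eq)
  finally show ?thesis .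
qed

text \<open>The test vector is arbitrary because the rows are needed in two ways: with \<open>x = y\<^sub>k\<close> they give the
scalar equations, with all \<open>x\<close> they express the vanishing of a block.\<close>

lemma saddle_mat_row:
  assumes A: "\<And>k. k \<le> N \<Longrightarrow> A k \<in> carrier_mat (n k) (n k)"
    and B: "\<And>k. 1 \<le> k \<Longrightarrow> k \<le> N \<Longrightarrow> B k \<in> carrier_mat (n k) (n (k - 1))"
    and y: "y \<in> carrier_vec (block_start n (Suc N))" and k: "k \<le> N" and x: "x \<in> carrier_vec (n k)"
  shows "conjugate x \<bullet> vec_block n (map_mat complex_of_real (saddle_mat n N A B) *\<^sub>v y) k
    = (- 1) ^ k * sesq_form (A k) x (vec_block n y k)
      + (if 0 < k then sesq_form (B k) x (vec_block n y (k - 1)) else 0)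
      + (if k < N then sesq_form (B (Suc k))\<^sup>T x (vec_block n y (Suc k)) else 0)"
proof -
  let ?F = "\<lambda>k l. if k = l then (- 1) ^ k \<cdot>\<^sub>m A k else if k = Suc l then B k
      else if l = Suc k then (B l)\<^sup>T else 0\<^sub>m (n k) (n l)"
  have F: "?F k l \<in> carrier_mat (n k) (n l)" if "k \<le> N" "l \<le> N" for k l
    using A[OF that(1)] B[of k] B[of l] that by auto
  have "conjugate x \<bullet> vec_block n (map_mat complex_of_real (saddle_mat n N A B) *\<^sub>v y) k
      = (\<Sum>l\<le>N. sesq_form (?F k l) x (vec_block n y l))"
    unfolding saddle_mat_def by (rule sesq_form_block_row[OF F y k x])
  also have "\<dots> = (\<Sum>l\<le>N. if k = l then (- 1) ^ k * sesq_form (A k) x (vec_block n y l)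
      else if k = Suc l then sesq_form (B k) x (vec_block n y l)
      else if l = Suc k then sesq_form (B l)\<^sup>T x (vec_block n y l) else 0)"
    by (intro sum.cong refl) (use A[OF k] x in \<open>auto simp: sesq_form_smult_mat\<close>)
  finally show ?thesis by (simp only: sum_tridiagonal[OF k])
qed

lemma precond_mat_row:
  assumes S: "\<And>k. k \<le> N \<Longrightarrow> S k \<in> carrier_mat (n k) (n k)"
    and B: "\<And>k. 1 \<le> k \<Longrightarrow> k \<le> N \<Longrightarrow> B k \<in> carrier_mat (n k) (n (k - 1))"
    and y: "y \<in> carrier_vec (block_start n (Suc N))" and k: "k \<le> N" and x: "x \<in> carrier_vec (n k)"
  shows "conjugate x \<bullet> vec_block n (map_mat complex_of_real (precond_mat n N S B) *\<^sub>v y) k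
    = (- 1) ^ k * sesq_form (S k) x (vec_block n y k)
      + (if k < N then sesq_form (B (Suc k))\<^sup>T x (vec_block n y (Suc k)) else 0)"
proof -
  let ?F = "\<lambda>k l. if k = l then (- 1) ^ k \<cdot>\<^sub>m S k else if l = Suc k then (B l)\<^sup>T else 0\<^sub>m (n k) (n l)"
  have F: "?F k l \<in> carrier_mat (n k) (n l)" if "k \<le> N" "l \<le> N" for k l
    using S[OF that(1)] B[of l] that by auto
  have "conjugate x \<bullet> vec_block n (map_mat complex_of_real (precond_mat n N S B) *\<^sub>v y) k
      = (\<Sum>l\<le>N. sesq_form (?F k l) x (vec_block n y l))"
    unfolding precond_mat_def by (rule sesq_form_block_row[OF F y k x])
  also have "\<dots> = (\<Sum>l\<le>N. if k = l then (- 1) ^ k * sesq_form (S k) x (vec_block n y l)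
      else if k = Suc l then 0
      else if l = Suc k then sesq_form (B l)\<^sup>T x (vec_block n y l) else 0)"
    by (intro sum.cong refl) (use S[OF k] x in \<open>auto simp: sesq_form_smult_mat\<close>)
  finally show ?thesis by (simp only: sum_tridiagonal[OF k] if_cancel add_0_right)
qed

text \<open>The sign \<open>(- 1) ^ k\<close> in the coupling terms turns the alternating signs of the diagonal blocks into
the uniform rows needed for \<open>complex_coupling_bound\<close>. Full rank of the \<open>B\<^sub>k\<close> enters through the first
block of the eigenvector: if it vanished, the rows would successively force all others to vanish.\<close>

lemma nonreal_eigenvalue_bound:
  assumes N: "N \<ge> 1"
    and A: "\<And>k. k \<le> N \<Longrightarrow> A k \<in> carrier_mat (n k) (n k)"
    and A0: "sym_pos_def (A 0)"
    and Ak: "\<And>k. 1 \<le> k \<Longrightarrow> k \<le> N \<Longrightarrow> sym_pos_semidef (A k)"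
    and B: "\<And>k. 1 \<le> k \<Longrightarrow> k \<le> N \<Longrightarrow> B k \<in> carrier_mat (n k) (n (k - 1))"
    and rank: "\<And>k. 1 \<le> k \<Longrightarrow> k \<le> N \<Longrightarrow> vec_space.rank (n k) (B k) = n k"
    and S: "\<And>k. k \<le> N \<Longrightarrow> S k \<in> carrier_mat (n k) (n k)" "\<And>k. k \<le> N \<Longrightarrow> sym_pos_def (S k)"
    and y: "y \<in> carrier_vec (block_start n (Suc N))"
    and eq: "map_mat complex_of_real (saddle_mat n N A B) *\<^sub>v y
      = lam \<cdot>\<^sub>v (map_mat complex_of_real (precond_mat n N S B) *\<^sub>v y)"
    and norm: "(\<Sum>k\<le>N. Re (sesq_form (S k) (vec_block n y k) (vec_block n y k))) = 1"
    and Im: "Im lam \<noteq> 0"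
  shows "Re (sesq_form (A 0) (vec_block n y 0) (vec_block n y 0))
    + Re (sesq_form (A 1) (vec_block n y 1) (vec_block n y 1)) < 1 - (cmod (lam - 1))\<^sup>2"
proof -
  define Y where "Y k = vec_block n y k" for k
  have Y [simp]: "Y k \<in> carrier_vec (n k)" for k by (simp add: Y_def)
  define up where "up k x = (if k < N then sesq_form (B (Suc k))\<^sup>T x (Y (Suc k)) else 0)" for k x
  have row: "(- 1) ^ k * sesq_form (A k) x (Y k)
      + (if 0 < k then sesq_form (B k) x (Y (k - 1)) else 0) + up k x
      = lam * ((- 1) ^ k * sesq_form (S k) x (Y k) + up k x)"
    if k: "k \<le> N" and x: "x \<in> carrier_vec (n k)" for k x
  proof -
    let ?P = "map_mat complex_of_real (precond_mat n N S B)"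
    have "?P *\<^sub>v y \<in> carrier_vec (block_start n (Suc N))"
      using y block_mat_carrier by (auto simp: precond_mat_def intro!: mult_mat_vec_carrier[of _ _ "block_start n (Suc N)"])
    from carrier_vecD[OF this]
    have "vec_block n (lam \<cdot>\<^sub>v (?P *\<^sub>v y)) k = lam \<cdot>\<^sub>v vec_block n (?P *\<^sub>v y) k"
      using block_start_add_less[OF k, of _ n]
      by (intro eq_vecI) (auto simp: vec_block_def simp del: dim_mult_mat_vec index_mult_mat_vec)
    then have "conjugate x \<bullet> vec_block n (lam \<cdot>\<^sub>v (?P *\<^sub>v y)) k = lam * (conjugate x \<bullet> vec_block n (?P *\<^sub>v y) k)"
      using scalar_prod_smult_distrib[of "conjugate x" "n k" "vec_block n (?P *\<^sub>v y) k" lam] x by simp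
    then show ?thesis
      unfolding eq[symmetric]
      by (simp only: saddle_mat_row[OF A B y k x] precond_mat_row[OF S(1) B y k x] up_def Y_def)
  qed
  have lam1: "lam \<noteq> 1" using Im by auto
  have Y0: "Y 0 \<noteq> 0\<^sub>v (n 0)"
  proof
    assume zero: "Y 0 = 0\<^sub>v (n 0)"
    have "k \<le> N \<Longrightarrow> Y k = 0\<^sub>v (n k) \<and> (0 < k \<longrightarrow> Y (k - 1) = 0\<^sub>v (n (k - 1)))" for k
    proof (induction k)
      case 0
      show ?case using zero by simp
    next
      case (Suc k)
      then have k: "k < N" "k \<le> N" and IH: "Y k = 0\<^sub>v (n k)" "0 < k \<longrightarrow> Y (k - 1) = 0\<^sub>v (n (k - 1))" by auto
      have "sesq_form (B (Suc k))\<^sup>T x (Y (Suc k)) = 0" if x: "x \<in> carrier_vec (n k)" for x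
      proof -
        have "sesq_form (A k) x (Y k) = 0" "sesq_form (S k) x (Y k) = 0"
          "(if 0 < k then sesq_form (B k) x (Y (k - 1)) else 0) = 0"
          using IH A[OF k(2)] S(1)[OF k(2)] B[of k] k x by (auto simp: sesq_form_zero_right)
        then have "up k x = lam * up k x"
          using row[OF k(2) x] by (simp only: mult_zero_right add_0_left)
        then have "(1 - lam) * up k x = 0" by (simp add: algebra_simps)
        then show ?thesis using lam1 k by (simp add: up_def)
      qed
      then have "Y (Suc k) = 0\<^sub>v (n (Suc k))"
        using full_row_rank_sesq_form_injective[of "B (Suc k)" "n (Suc k)" "n k" "Y (Suc k)"]
          B[of "Suc k"] rank[of "Suc k"] Suc.prems by simp
      with IH show ?case by simp
    qed
    then have "Re (sesq_form (S k) (Y k) (Y k)) = 0" if "k \<le> N" for k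
      using sesq_form_zero_right[OF S(1)[OF that] Y] that by simp
    then have "(\<Sum>k\<le>N. Re (sesq_form (S k) (Y k) (Y k))) = 0" by simp
    with norm show False by (simp add: Y_def)
  qed
  define p where "p k = (if 0 < k \<and> k \<le> N then (- 1) ^ k * sesq_form (B k) (Y k) (Y (k - 1)) else 0)" for k
  define w where "w k = Re (sesq_form (S k) (Y k) (Y k))" for k
  define e where "e k = Re (sesq_form (A k) (Y k) (Y k))" for k
  have A_sym: "(A k)\<^sup>T = A k" if "k \<le> N" for k
    using A0 Ak[of k] that by (cases k) (auto simp: sym_pos_def_def sym_pos_semidef_def)
  have e: "sesq_form (A k) (Y k) (Y k) = of_real (e k)" if "k \<le> N" for k
    using sesq_form_symmetric_real[OF A[OF that] A_sym[OF that] Y] by (simp add: e_def complex_eq_iff)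
  have w: "sesq_form (S k) (Y k) (Y k) = of_real (w k)" if "k \<le> N" for k
    using sesq_form_symmetric_real[OF S(1)[OF that] sym_pos_defD(1)[OF S(2)[OF that] S(1)[OF that]] Y]
    by (simp add: w_def complex_eq_iff)
  have "e 0 + e 1 < 1 - (cmod (lam - 1))\<^sup>2"
  proof (rule complex_coupling_bound[of p N "lam - 1" w e])
    fix k assume k: "k \<le> N"
    \<comment> \<open>The term above the diagonal is the conjugate of the term below it in the next row. For \<open>k = N\<close>
      both sides vanish by the default values of \<open>up\<close> and \<open>p\<close>.\<close>
    have up: "(- 1) ^ k * up k (Y k) = - cnj (p (Suc k))"
      using cnj_sesq_form[of "B (Suc k)" "n (Suc k)" "n k" "Y (Suc k)" "Y k"] B[of "Suc k"]
      by (auto simp: up_def p_def)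
    have sq: "(- 1) ^ k * ((- 1) ^ k * z) = z" for z :: complex
      by (simp flip: mult.assoc power_add)
    have p: "(- 1) ^ k * (if 0 < k then sesq_form (B k) (Y k) (Y (k - 1)) else 0) = p k"
      using k by (simp add: p_def)
    from arg_cong[OF row[OF k Y], of "\<lambda>z. (- 1) ^ k * z"]
    have "of_real (e k) + p k + (- 1) ^ k * up k (Y k)
        = lam * (of_real (w k) + (- 1) ^ k * up k (Y k))"
      unfolding e[OF k] w[OF k] distrib_left sq p
      by (simp only: mult.left_commute[of "(- 1) ^ k" lam] distrib_left sq)
    then show "p k + (lam - 1) * cnj (p (Suc k)) = (1 + (lam - 1)) * of_real (w k) - of_real (e k)"
      unfolding up by (simp add: algebra_simps)
    show "w k \<ge> 0" using sesq_form_pos_def_pos[OF S(2)[OF k] S(1)[OF k] Y]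
        sesq_form_zero_right[OF S(1)[OF k] Y]
      by (cases "Y k = 0\<^sub>v (n k)") (auto simp: w_def less_imp_le)
    show "e k \<ge> 0"
    proof (cases "k = 0")
      case True
      then show ?thesis using sesq_form_pos_def_pos[OF A0 A Y Y0] by (simp add: e_def less_imp_le)
    next
      case False
      then show ?thesis using sesq_form_semidef_nonneg[OF Ak A Y] k by (simp add: e_def)
    qed
  next
    show "w 0 > 0" using sesq_form_pos_def_pos[OF S(2,1) Y Y0] by (simp add: w_def)
    show "e 0 > 0" using sesq_form_pos_def_pos[OF A0 A Y Y0] by (simp add: e_def)
    show "(\<Sum>k\<le>N. w k) = 1" using norm by (simp add: w_def Y_def)
  qed (use N Im in \<open>auto simp: p_def\<close>)
  then show ?thesis by (simp add: e_def Y_def)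
qed

text \<open>Substituting \<open>y = D\<^sup>-\<^sup>1\<^sup>/\<^sup>2 u\<close> and cancelling the left factor \<open>D\<^sup>-\<^sup>1\<^sup>/\<^sup>2\<close> turns the scaled eigenvalue
problem into the original one, whose block rows need no square roots.\<close>

lemma scaled_pencil_transform:
  assumes D: "sym_pos_def D" "D \<in> carrier_mat m m"
    and M: "M \<in> carrier_mat m m" and P: "P \<in> carrier_mat m m" and u: "u \<in> carrier_vec m"
    and eq: "map_mat complex_of_real (scaled_mat D M) *\<^sub>v u
      = lam \<cdot>\<^sub>v (map_mat complex_of_real (scaled_mat D P) *\<^sub>v u)"
  obtains y where "y \<in> carrier_vec m" "map_mat complex_of_real (sqrt_mat D) *\<^sub>v y = u"
    "map_mat complex_of_real M *\<^sub>v y = lam \<cdot>\<^sub>v (map_mat complex_of_real P *\<^sub>v y)"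
proof -
  let ?c = "map_mat complex_of_real"
  let ?X = "?c (sqrt_mat D)" and ?Q = "?c (inv_sqrt_mat D)"
  note X = sqrt_mat[OF D] and Q = inv_sqrt_mat[OF D]
  have cX: "?X \<in> carrier_mat m m" and cQ: "?Q \<in> carrier_mat m m" using X Q by auto
  have XQ: "?X * ?Q = 1\<^sub>m m"
    by (simp add: Q(3) of_real_hom.mat_hom_one flip: of_real_hom.mat_hom_mult[OF X(1) Q(1)])
  have XQv: "?X *\<^sub>v (?Q *\<^sub>v v) = v" if "v \<in> carrier_vec m" for v
    using that XQ by (simp flip: assoc_mult_mat_vec[OF cX cQ])
  define y where "y = ?Q *\<^sub>v u"
  have y: "y \<in> carrier_vec m" using cQ u by (simp add: y_def)
  have scaled: "?c (scaled_mat D K) *\<^sub>v u = ?Q *\<^sub>v (?c K *\<^sub>v y)" if K: "K \<in> carrier_mat m m" for K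
  proof -
    have cK: "?c K \<in> carrier_mat m m" using K by simp
    have "?c (scaled_mat D K) = ?Q * ?c K * ?Q"
      using Q(1) K by (simp add: scaled_mat_def of_real_hom.mat_hom_mult[of _ m m _ m]
          mult_carrier_mat[of _ m m _ m])
    then show ?thesis
      using cQ cK u y by (simp add: assoc_mult_mat_vec[of _ m m _ m] mult_carrier_mat[of _ m m _ m] y_def)
  qed
  have cM: "?c M *\<^sub>v y \<in> carrier_vec m" and cP: "?c P *\<^sub>v y \<in> carrier_vec m" using M P y by auto
  have "?c M *\<^sub>v y = ?X *\<^sub>v (?Q *\<^sub>v (?c M *\<^sub>v y))" using XQv[OF cM] by simp
  also have "\<dots> = ?X *\<^sub>v (lam \<cdot>\<^sub>v (?Q *\<^sub>v (?c P *\<^sub>v y)))" using eq scaled[OF M] scaled[OF P] by simp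
  also have "\<dots> = lam \<cdot>\<^sub>v (?X *\<^sub>v (?Q *\<^sub>v (?c P *\<^sub>v y)))"
    using cX cQ cP by (intro mult_mat_vec[of _ m m]) auto
  also have "\<dots> = lam \<cdot>\<^sub>v (?c P *\<^sub>v y)" using XQv[OF cP] by simp
  finally show ?thesis using that[OF y] XQv[OF u] by (simp add: y_def)
qed

text \<open>In the unscaled block variable \<open>y = S\<^sup>-\<^sup>1\<^sup>/\<^sup>2 v\<close> the squared norm of \<open>v\<close> is the energy of \<open>S\<close>, and the
Rayleigh quotient bound for the scaled block becomes a bound on the energy of \<open>A\<close>.\<close>

lemma scaled_block_forms:
  assumes S: "sym_pos_def S" "S \<in> carrier_mat m m"
    and A: "A \<in> carrier_mat m m" "A\<^sup>T = A" and y: "y \<in> carrier_vec m"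
    and v: "v = map_mat complex_of_real (sqrt_mat S) *\<^sub>v y"
  shows "Re (sesq_form S y y) = (eucl_norm v)\<^sup>2"
    and "min_eigenvalue (scaled_mat S A) * (eucl_norm v)\<^sup>2 \<le> Re (sesq_form A y y)"
proof -
  let ?c = "map_mat complex_of_real"
  note X = sqrt_mat[OF S] and Q = inv_sqrt_mat[OF S]
  note XT = sym_pos_defD(1)[OF X(2,1)]
  have vc: "v \<in> carrier_vec m" using X(1) y by (simp add: v)
  have "S = (sqrt_mat S)\<^sup>T * 1\<^sub>m m * sqrt_mat S" using X XT by simp
  then show "Re (sesq_form S y y) = (eucl_norm v)\<^sup>2"
    using sesq_form_congruence[OF X(1) one_carrier_mat y] sesq_form_one[OF vc] by (simp add: v)
  have cQ: "?c (inv_sqrt_mat S) \<in> carrier_mat m m" and cX: "?c (sqrt_mat S) \<in> carrier_mat m m"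
    using X(1) Q(1) by auto
  have "?c (inv_sqrt_mat S) * ?c (sqrt_mat S) = 1\<^sub>m m"
    by (simp add: Q(2) of_real_hom.mat_hom_one flip: of_real_hom.mat_hom_mult[OF Q(1) X(1)])
  then have Qv: "?c (inv_sqrt_mat S) *\<^sub>v v = y"
    unfolding v using y by (simp flip: assoc_mult_mat_vec[OF cQ cX])
  have E: "scaled_mat S A \<in> carrier_mat m m" using Q(1) A by (simp add: scaled_mat_def)
  have ET: "(scaled_mat S A)\<^sup>T = scaled_mat S A"
    using Q(1,4) A by (simp add: scaled_mat_def transpose_mult[of _ m m _ m] mult_carrier_mat[of _ m m _ m])
  have "sesq_form (scaled_mat S A) v v = sesq_form A y y"
    using sesq_form_congruence[OF Q(1) A(1) vc] by (simp add: Q(4) Qv scaled_mat_def)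
  then show "min_eigenvalue (scaled_mat S A) * (eucl_norm v)\<^sup>2 \<le> Re (sesq_form A y y)"
    using min_eigenvalue_sesq_form[OF E ET vc] by simp
qed

theorem theorem1:
  fixes N :: nat and n :: "nat \<Rightarrow> nat"
    and A B S :: "nat \<Rightarrow> real mat"
    and lam :: complex and u :: "complex vec"
  assumes "N \<ge> 1"
    and "\<And>k. k \<le> N \<Longrightarrow> n k \<ge> 1"
    and "\<And>k. 1 \<le> k \<Longrightarrow> k \<le> N \<Longrightarrow> n k \<le> n (k - 1)"
    and "\<And>k. k \<le> N \<Longrightarrow> A k \<in> carrier_mat (n k) (n k)"
    and "sym_pos_def (A 0)"
    and "\<And>k. 1 \<le> k \<Longrightarrow> k \<le> N \<Longrightarrow> sym_pos_semidef (A k)"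
    and "\<And>k. 1 \<le> k \<Longrightarrow> k \<le> N \<Longrightarrow> B k \<in> carrier_mat (n k) (n (k - 1))"
    and "\<And>k. 1 \<le> k \<Longrightarrow> k \<le> N \<Longrightarrow> vec_space.rank (n k) (B k) = n k"
    and "\<And>k. k \<le> N \<Longrightarrow> S k \<in> carrier_mat (n k) (n k)"
    and "\<And>k. k \<le> N \<Longrightarrow> sym_pos_def (S k)"
    and "eigenvalue
           (map_mat complex_of_real (the (mat_inverse (precond_mat n N S B)) * saddle_mat n N A B)) lam"
    and "u \<in> carrier_vec (\<Sum>k\<le>N. n k)"
    and "(\<Sum>k\<le>N. (eucl_norm (vec_block n u k))\<^sup>2) = 1"
    and "map_mat complex_of_real (scaled_mat (block_diag_mat n N S) (saddle_mat n N A B)) *\<^sub>v u =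
         lam \<cdot>\<^sub>v (map_mat complex_of_real
           (scaled_mat (block_diag_mat n N S) (precond_mat n N S B)) *\<^sub>v u)"
    and "\<And>k. 2 \<le> k \<Longrightarrow> k \<le> N \<Longrightarrow> vec_block n u k \<noteq> 0\<^sub>v (n k)"
  shows "let a = min_eigenvalue (scaled_mat (S 0) (A 0)) * (eucl_norm (vec_block n u 0))\<^sup>2
               + min_eigenvalue (scaled_mat (S 1) (A 1)) * (eucl_norm (vec_block n u 1))\<^sup>2
         in (a \<ge> 1 \<longrightarrow> Im lam = 0) \<and>
            (\<not> a \<ge> 1 \<and> Im lam \<noteq> 0 \<longrightarrow> cmod (lam - 1) < sqrt (1 - a) \<and> Re lam > a / 2)"
proof -
  note N = assms(1) and A = assms(4) and A0 = assms(5) and Ak = assms(6) and B = assms(7)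
    and rank = assms(8) and S = assms(9,10) and norm = assms(13) and eq = assms(14)
  define a where "a = min_eigenvalue (scaled_mat (S 0) (A 0)) * (eucl_norm (vec_block n u 0))\<^sup>2
      + min_eigenvalue (scaled_mat (S 1) (A 1)) * (eucl_norm (vec_block n u 1))\<^sup>2"
  let ?m = "block_start n (Suc N)"
  have u: "u \<in> carrier_vec ?m"
    using assms(12) by (simp add: block_start_def lessThan_Suc_atMost)
  have M: "saddle_mat n N A B \<in> carrier_mat ?m ?m" and P: "precond_mat n N S B \<in> carrier_mat ?m ?m"
    by (simp_all add: saddle_mat_def precond_mat_def)
  obtain y where y: "y \<in> carrier_vec ?m"
    and uy: "map_mat complex_of_real (sqrt_mat (block_diag_mat n N S)) *\<^sub>v y = u"
    and eqy: "map_mat complex_of_real (saddle_mat n N A B) *\<^sub>v y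
      = lam \<cdot>\<^sub>v (map_mat complex_of_real (precond_mat n N S B) *\<^sub>v y)"
    using scaled_pencil_transform[OF block_diag_sym_pos_def[OF S] block_diag_carrier M P u eq] by blast
  have uk: "vec_block n u k = map_mat complex_of_real (sqrt_mat (S k)) *\<^sub>v vec_block n y k"
    if "k \<le> N" for k
    using vec_block_mult_complex_block_diag[of N "\<lambda>k. sqrt_mat (S k)" n y k] sqrt_mat(1)[OF S(2,1)]
      sqrt_mat_block_diag[OF S] uy y that by simp
  have A_sym: "(A k)\<^sup>T = A k" if "k \<le> N" for k
    using A0 Ak[of k] that by (cases k) (auto simp: sym_pos_def_def sym_pos_semidef_def)
  note forms = scaled_block_forms[OF S(2,1) A A_sym vec_block_carrier uk]
  have "(\<Sum>k\<le>N. Re (sesq_form (S k) (vec_block n y k) (vec_block n y k))) = 1"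
    unfolding norm[symmetric] by (intro sum.cong refl forms(1)) auto
  then have bound: "a < 1 - (cmod (lam - 1))\<^sup>2" if "Im lam \<noteq> 0"
    using nonreal_eigenvalue_bound[OF N A A0 Ak B rank S y eqy _ that] forms(2)[of 0] forms(2)[of 1] N
    by (simp add: a_def)
  have disc: "cmod (lam - 1) < sqrt (1 - a)" if "Im lam \<noteq> 0"
    using bound[OF that] by (intro real_less_rsqrt) simp
  have half: "Re lam > a / 2" if "Im lam \<noteq> 0"
  proof -
    \<comment> \<open>A disc of squared radius \<open>1 - a\<close> around 1 lies to the right of the vertical line at \<open>a / 2\<close>.\<close>
    have "(cmod (lam - 1))\<^sup>2 = (cmod lam)\<^sup>2 - 2 * Re lam + 1"
      unfolding cmod_power2 by (simp add: power2_eq_square algebra_simps)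
    with bound[OF that] show ?thesis using zero_le_power2[of "cmod lam"] by linarith
  qed
  have "Im lam = 0" if "a \<ge> 1"
    using bound that zero_le_power2[of "cmod (lam - 1)"] by (rule_tac ccontr) linarith
  with disc half show ?thesis unfolding Let_def a_def[symmetric] by blast
qed

end
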